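(* Let $q\geq 2$ be a prime power. Neither $\mathrm{PSL}(3,q)$ nor $\mathrm{PSU}(3,q)$ is the automorphism group of a chiral polytope of rank greater than five.
   Context: $\mathrm{PSL}(3,q)$ is the projective special linear group of degree $3$ over the field $\mathbb{F}_q$ of order $q$; $\mathrm{PSU}(3,q)$ is the projective special unitary group of degree $3$ defined over $\mathbb{F}_{q^2}$. Chiral polytopes are described through groups. Let $G$ be a group, $r\ge 3$, and $(\sigma_1,\dots,\sigma_{r-1})$ a tuple of elements of $G$. For $1\le i\le j\le r-1$ put $\tau_{i,j}=\sigma_i\sigma_{i+1}\cdots\sigma_j$ (so $\tau_{i,i}=\sigma_i$). The pair $(G,(\sigma_1,\dots,\sigma_{r-1}))$ gives a chiral polytope of rank $r$ with automorphism group $G$ if the $\sigma_i$ generate $G$ and: (1) (string property) $\tau_{i,j}$ is an involution (element of order exactly $2$) whenever $1\le i<j\le r-1$; (2) (intersection property) for all $I,J\subseteq\{0,\dots,r-1\}$, $\langle \tau_{i,j} \mid i\le j,\ i-1,j\notin I\rangle\cap\langle \tau_{i,j}\mid i\le j,\ i-1,j\notin J\rangle=\langle \tau_{i,j}\mid i\le j,\ i-1,j\notin I\cup J\rangle$; (3) (chirality) there is no automorphism of $G$ sending $\sigma_1$ to $\sigma_1^{-1}$ and fixing $\tau_{1,i}$ for all $i=2,\dots,r-1$. A group is the automorphism group of a chiral polytope of rank $r$ if and only if such a tuple exists. *)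

theory Defs
  imports
    "HOL-Analysis.Determinants"
    "HOL-Algebra.Multiplicative_Group"
    "HOL-Algebra.Generated_Groups"
    "HOL-Number_Theory.Prime_Powers"
    "HOL-Number_Theory.Residues"
begin

definition SL :: "('a::field ^ 'n::finite ^ 'n) monoid" where
  "SL = \<lparr>carrier = {A. det A = 1}, mult = (**), one = mat 1\<rparr>"

text \<open>The field of the unitary group of parameter \<open>q\<close> has \<open>q\<^sup>2\<close> elements; its involutory
  automorphism \<open>x \<mapsto> x^q\<close> plays the role of complex conjugation. Nondegenerate
  Hermitian forms over a finite field are all equivalent, so the standard one is used.\<close>

definition conj_transpose :: "nat \<Rightarrow> 'a::field ^ 'n::finite ^ 'n \<Rightarrow> 'a ^ 'n ^ 'n" where
  "conj_transpose q A = transpose (map_matrix (\<lambda>x. x ^ q) A)"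

definition SU :: "nat \<Rightarrow> ('a::field ^ 'n::finite ^ 'n) monoid" where
  "SU q = \<lparr>carrier = {A. det A = 1 \<and> A ** conj_transpose q A = mat 1}, mult = (**), one = mat 1\<rparr>"

definition scalars :: "('a::field ^ 'n::finite ^ 'n) monoid \<Rightarrow> ('a ^ 'n ^ 'n) set" where
  "scalars G = {A \<in> carrier G. \<exists>c. A = mat c}"

definition PSL :: "('a::field ^ 'n::finite ^ 'n) set monoid" where
  "PSL = SL Mod scalars SL"

definition PSU :: "nat \<Rightarrow> ('a::field ^ 'n::finite ^ 'n) set monoid" where
  "PSU q = SU q Mod scalars (SU q)"

text \<open>A tuple \<open>(\<sigma>\<^sub>1, \<dots>, \<sigma>\<^bsub>r-1\<^esub>)\<close> is a function on \<open>nat\<close> of which only the values at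
  \<open>{1..r-1}\<close> are used.\<close>

definition tau :: "('a, 'm) monoid_scheme \<Rightarrow> (nat \<Rightarrow> 'a) \<Rightarrow> nat \<Rightarrow> nat \<Rightarrow> 'a" where
  "tau G \<sigma> i j = foldr (\<lambda>x y. x \<otimes>\<^bsub>G\<^esub> y) (map \<sigma> [i..<Suc j]) \<one>\<^bsub>G\<^esub>"

definition string_property :: "('a, 'm) monoid_scheme \<Rightarrow> nat \<Rightarrow> (nat \<Rightarrow> 'a) \<Rightarrow> bool" where
  "string_property G r \<sigma> \<longleftrightarrow>
     (\<forall>i j. 1 \<le> i \<and> i < j \<and> j \<le> r - 1 \<longrightarrow> group.ord G (tau G \<sigma> i j) = 2)"

definition tau_subgroup ::
    "('a, 'm) monoid_scheme \<Rightarrow> nat \<Rightarrow> (nat \<Rightarrow> 'a) \<Rightarrow> nat set \<Rightarrow> 'a set" where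
  "tau_subgroup G r \<sigma> I =
     generate G {tau G \<sigma> i j | i j. 1 \<le> i \<and> i \<le> j \<and> j \<le> r - 1 \<and> i - 1 \<notin> I \<and> j \<notin> I}"

definition intersection_property :: "('a, 'm) monoid_scheme \<Rightarrow> nat \<Rightarrow> (nat \<Rightarrow> 'a) \<Rightarrow> bool" where
  "intersection_property G r \<sigma> \<longleftrightarrow>
     (\<forall>I J. I \<subseteq> {0..r - 1} \<and> J \<subseteq> {0..r - 1} \<longrightarrow>
        tau_subgroup G r \<sigma> I \<inter> tau_subgroup G r \<sigma> J = tau_subgroup G r \<sigma> (I \<union> J))"

definition chirality :: "('a, 'm) monoid_scheme \<Rightarrow> nat \<Rightarrow> (nat \<Rightarrow> 'a) \<Rightarrow> bool" where
  "chirality G r \<sigma> \<longleftrightarrow>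
     \<not> (\<exists>\<phi> \<in> iso G G. \<phi> (\<sigma> 1) = inv\<^bsub>G\<^esub> (\<sigma> 1) \<and>
          (\<forall>i \<in> {2..r - 1}. \<phi> (tau G \<sigma> 1 i) = tau G \<sigma> 1 i))"

definition gives_chiral_polytope ::
    "('a, 'm) monoid_scheme \<Rightarrow> nat \<Rightarrow> (nat \<Rightarrow> 'a) \<Rightarrow> bool" where
  "gives_chiral_polytope G r \<sigma> \<longleftrightarrow>
     3 \<le> r \<and>
     \<sigma> ` {1..r - 1} \<subseteq> carrier G \<and>
     generate G (\<sigma> ` {1..r - 1}) = carrier G \<and>
     string_property G r \<sigma> \<and> intersection_property G r \<sigma> \<and> chirality G r \<sigma>"

text \<open>A group is the automorphism group of a chiral polytope of rank \<open>r\<close> iff it admits such a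
  tuple; this is taken as the definition.\<close>

definition is_aut_group_of_chiral_polytope :: "('a, 'm) monoid_scheme \<Rightarrow> nat \<Rightarrow> bool" where
  "is_aut_group_of_chiral_polytope G r \<longleftrightarrow> (\<exists>\<sigma>. gives_chiral_polytope G r \<sigma>)"

text \<open>\<open>group.ord\<close> is specified only for groups, so the string property is meaningful for
  \<open>PSL\<close> and \<open>PSU q\<close> because of \<open>group_PSL\<close> and \<open>group_PSU\<close> below.\<close>

lemma mat_mult_left:
  fixes A :: "'a::field ^ 'n::finite ^ 'n"
  shows "(mat c ** A) $ i $ j = c * A $ i $ j"
proof -
  have "(mat c ** A) $ i $ j = (\<Sum>k\<in>UNIV. (if i = k then c else 0) * A $ k $ j)"
    by (simp add: matrix_matrix_mult_def mat_def)
  also have "\<dots> = (\<Sum>k\<in>UNIV. if i = k then c * A $ k $ j else 0)"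
    by (rule sum.cong) simp_all
  finally show ?thesis by simp
qed

lemma mat_mult_right:
  fixes A :: "'a::field ^ 'n::finite ^ 'n"
  shows "(A ** mat c) $ i $ j = c * A $ i $ j"
proof -
  have "(A ** mat c) $ i $ j = (\<Sum>k\<in>UNIV. A $ i $ k * (if k = j then c else 0))"
    by (simp add: matrix_matrix_mult_def mat_def)
  also have "\<dots> = (\<Sum>k\<in>UNIV. if k = j then c * A $ i $ k else 0)"
    by (rule sum.cong) simp_all
  finally show ?thesis by simp
qed

lemma mat_commute:
  fixes A :: "'a::field ^ 'n::finite ^ 'n"
  shows "mat c ** A = A ** mat c"
  by (subst vec_eq_iff, subst vec_eq_iff) (simp add: mat_mult_left mat_mult_right)

lemma mat_mult_mat: "mat a ** mat b = (mat (a * b) :: 'a::field ^ 'n::finite ^ 'n)"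
  by (subst vec_eq_iff, subst vec_eq_iff) (simp add: mat_mult_left, simp add: mat_def)

lemma group_SL: "group (SL :: ('a::field ^ 'n::finite ^ 'n) monoid)"
proof (rule groupI)
  fix A :: "'a ^ 'n ^ 'n" assume "A \<in> carrier SL"
  then have d: "det A = 1" by (simp add: SL_def)
  then obtain B where B: "B ** A = mat 1"
    using invertible_det_nz[of A] invertible_left_inverse[of A] by auto
  then have "det B = 1" using d det_mul[of B A] by simp
  with B show "\<exists>B\<in>carrier SL. B \<otimes>\<^bsub>SL\<^esub> A = \<one>\<^bsub>SL\<^esub>" by (auto simp: SL_def)
qed (auto simp: SL_def det_mul matrix_mul_assoc)

lemma normal_scalars:
  fixes G :: "('a::field ^ 'n::finite ^ 'n) monoid"
  assumes G: "group G" and m: "mult G = (**)" and o: "one G = mat 1"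
  shows "scalars G \<lhd> G"
proof -
  interpret group G by fact
  have comm: "x ** A = A ** x" if "A \<in> scalars G" for x A
    using that by (auto simp: scalars_def mat_commute)
  show ?thesis
  proof (rule normal_invI)
    show "subgroup (scalars G) G"
    proof (rule subgroupI)
      show "scalars G \<noteq> {}" using o one_closed by (auto simp: scalars_def)
    next
      fix A assume A: "A \<in> scalars G"
      then obtain c where c: "A = mat c" and AG: "A \<in> carrier G" by (auto simp: scalars_def)
      let ?B = "inv\<^bsub>G\<^esub> A"
      have BA: "?B ** A = mat 1" using l_inv[OF AG] m o by simp
      have "c \<noteq> 0"
      proof
        assume "c = 0"
        then have "(mat 1 :: 'a ^ 'n ^ 'n) = mat 0"
          using BA c by (simp add: matrix_matrix_mult_def mat_def vec_eq_iff)
        then have "(mat 1 :: 'a ^ 'n ^ 'n) $ i $ i = mat 0 $ i $ i" for i by simp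
        then show False by (simp add: mat_def)
      qed
      then have "A ** mat (inverse c) = mat 1" using c by (simp add: mat_mult_mat)
      then have "?B = mat (inverse c)"
        by (metis BA matrix_mul_assoc matrix_mul_lid matrix_mul_rid)
      then show "?B \<in> scalars G" using inv_closed[OF AG] unfolding scalars_def by blast
    next
      fix A B assume "A \<in> scalars G" "B \<in> scalars G"
      then show "A \<otimes>\<^bsub>G\<^esub> B \<in> scalars G"
        using m_closed m by (auto simp: scalars_def mat_mult_mat)
    qed (auto simp: scalars_def)
  next
    fix x h assume x: "x \<in> carrier G" and h: "h \<in> scalars G"
    then have hG: "h \<in> carrier G" by (simp add: scalars_def)
    have "x \<otimes>\<^bsub>G\<^esub> h = h \<otimes>\<^bsub>G\<^esub> x" using comm[OF h] m by simp
    then have "x \<otimes>\<^bsub>G\<^esub> h \<otimes>\<^bsub>G\<^esub> inv\<^bsub>G\<^esub> x = h" using x hG by (simp add: m_assoc)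
    then show "x \<otimes>\<^bsub>G\<^esub> h \<otimes>\<^bsub>G\<^esub> inv\<^bsub>G\<^esub> x \<in> scalars G" using h by simp
  qed
qed

lemma group_PSL: "group (PSL :: ('a::field ^ 'n::finite ^ 'n) set monoid)"
  unfolding PSL_def
  by (intro normal.factorgroup_is_group normal_scalars group_SL) (simp_all add: SL_def)

lemma power_add_of_card:
  assumes q: "primepow q" and card: "CARD('a::{field,finite}) = q ^ 2"
  shows "(x + y :: 'a) ^ q = x ^ q + y ^ q"
proof -
  obtain p k where p: "prime p" "k > 0" "q = p ^ k" using q by (auto simp: primepow_def)
  have "CHAR('a) dvd CARD('a)" by (rule CHAR_dvd_CARD)
  then have d: "CHAR('a) dvd p ^ (k * 2)" by (simp add: card p(3) power_mult)
  have pr: "prime CHAR('a)" by (rule prime_CHAR_semidom) (simp add: finite_imp_CHAR_pos)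
  have "CHAR('a) = p"
    using d p(1) pr prime_dvd_power primes_dvd_imp_eq by blast
  then show ?thesis using freshmans_dream'[where ?'a = 'a, OF pr, of q k x y] p(3) by simp
qed

lemma conj_transpose_mult:
  assumes q: "primepow q" and card: "CARD('a::{field,finite}) = q ^ 2"
  shows "conj_transpose q (A ** B) = conj_transpose q B ** conj_transpose q (A :: 'a ^ 'n::finite ^ 'n)"
proof -
  have "q > 0" using q by (rule primepow_gt_0_nat)
  then have z: "(0::'a) ^ q = 0" by simp
  have s: "sum f S ^ q = (\<Sum>i\<in>S. f i ^ q)" if "finite S" for f :: "'n \<Rightarrow> 'a" and S
    using that by (induction S) (simp_all add: z power_add_of_card[OF q card])
  show ?thesis
    by (simp add: conj_transpose_def matrix_matrix_mult_def transpose_def vec_eq_iff s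
        power_mult_distrib mult.commute)
qed

lemma group_SU:
  assumes q: "primepow q" and card: "CARD('a::{field,finite}) = q ^ 2"
  shows "group (SU q :: ('a ^ 'n::finite ^ 'n) monoid)"
proof (rule groupI)
  note ct = conj_transpose_mult[OF q card]
  have q0: "q > 0" using q by (rule primepow_gt_0_nat)
  have one: "conj_transpose q (mat 1) = (mat 1 :: 'a ^ 'n ^ 'n)"
    using q0 by (simp add: conj_transpose_def transpose_def mat_def vec_eq_iff)
  show "\<one>\<^bsub>SU q\<^esub> \<in> carrier (SU q :: ('a ^ 'n ^ 'n) monoid)" by (simp add: SU_def one)
  fix A :: "'a ^ 'n ^ 'n" assume "A \<in> carrier (SU q)"
  then have d: "det A = 1" and u: "A ** conj_transpose q A = mat 1" by (auto simp: SU_def)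
  {
    fix B :: "'a ^ 'n ^ 'n" assume "B \<in> carrier (SU q)"
    then have d': "det B = 1" and u': "B ** conj_transpose q B = mat 1" by (auto simp: SU_def)
    have "(A ** B) ** conj_transpose q (A ** B) = A ** (B ** conj_transpose q B) ** conj_transpose q A"
      by (simp only: ct matrix_mul_assoc)
    then show "A \<otimes>\<^bsub>SU q\<^esub> B \<in> carrier (SU q)" using d d' u u' by (simp add: SU_def det_mul)
  }
  let ?B = "conj_transpose q A"
  have BA: "?B ** A = mat 1" using u matrix_left_right_inverse by blast
  have "det ?B = 1" using u d det_mul[of A ?B] by simp
  moreover have "?B ** conj_transpose q ?B = mat 1" using u one ct[of A ?B] ct[of ?B A] BA
    by metis
  ultimately have "?B \<in> carrier (SU q)" unfolding SU_def by simp
  then show "\<exists>B\<in>carrier (SU q). B \<otimes>\<^bsub>SU q\<^esub> A = \<one>\<^bsub>SU q\<^esub>"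
    by (rule bexI[rotated]) (simp add: SU_def BA)
next
  fix A B C :: "'a ^ 'n ^ 'n"
  show "A \<otimes>\<^bsub>SU q\<^esub> B \<otimes>\<^bsub>SU q\<^esub> C = A \<otimes>\<^bsub>SU q\<^esub> (B \<otimes>\<^bsub>SU q\<^esub> C)"
    by (simp add: SU_def matrix_mul_assoc)
  show "\<one>\<^bsub>SU q\<^esub> \<otimes>\<^bsub>SU q\<^esub> A = A" by (simp add: SU_def)
qed

lemma group_PSU:
  assumes "primepow q" and "CARD('a::{field,finite}) = q ^ 2"
  shows "group (PSU q :: ('a ^ 'n::finite ^ 'n) set monoid)"
  unfolding PSU_def
  by (intro normal.factorgroup_is_group normal_scalars group_SU assms) (simp_all add: SU_def)

end

theory Submission
  imports Defs "HOL-Computational_Algebra.Polynomial"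
begin

text \<open>
  Think of \<open>\<tau>\<^sub>i\<^sub>j\<close> as \<open>\<rho>\<^bsub>i-1\<^esub>\<rho>\<^sub>j\<close> for formal reflections \<open>\<rho>\<^sub>0, \<dots>, \<rho>\<^sub>n\<close>, where \<open>n = r - 1 \<ge> 5\<close>; chirality says
  that conjugation by \<open>\<rho>\<^sub>0\<close> is not realised by an automorphism. The elements \<open>\<sigma>\<^sub>1\<close> and \<open>\<sigma>\<^sub>n\<close> commute, so
  their lifts to \<open>3 \<times> 3\<close> matrices of determinant \<open>1\<close> commute up to a cube root of unity \<open>\<omega>\<close>.

  If \<open>\<omega> = 1\<close>, the centralizer of the lift of \<open>\<sigma>\<^sub>n\<close> contains the lifts of \<open>\<sigma>\<^sub>1\<close> and \<open>\<sigma>\<^sub>2\<close>. These do not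
  commute, since otherwise \<open>\<sigma>\<^sub>1\<close> would be an involution and the identity map would violate chirality. A
  \<open>3 \<times> 3\<close> matrix with nonabelian centralizer is a scalar plus a matrix of rank one; being inverted modulo
  scalars but not an involution, it is a multiple of a transvection. The same holds for \<open>\<sigma>\<^sub>1\<close>, and the common
  centre or axis of the two transvections is invariant under the whole group, which is irreducible.

  If \<open>\<omega> \<noteq> 1\<close>, then \<open>n = 5\<close>, and in a suitable basis all generators are explicit enough to see that the
  inverse transpose map induces the automorphism that conjugation by \<open>\<rho>\<^sub>5\<close> should be, contradicting
  chirality. (This case does arise for subgroups: the alternating group of degree \<open>7\<close> inside \<open>PSU(3,5)\<close>.)
\<close>

section \<open>Rank one matrices and cyclic vectors\<close>

definition outer :: "'a::field ^ 'n \<Rightarrow> 'a ^ 'm \<Rightarrow> 'a ^ 'm ^ 'n" where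
  "outer v f = (\<chi> i j. v $ i * f $ j)"

definition dot :: "'a::field ^ 'n \<Rightarrow> 'a ^ 'n \<Rightarrow> 'a" where
  "dot f x = (\<Sum>i\<in>UNIV. f $ i * x $ i)"

lemma mult_outer: "A ** outer v f = outer (A *v v) f"
  by (simp add: outer_def matrix_matrix_mult_def matrix_vector_mult_def vec_eq_iff
      sum_distrib_right mult.assoc)

lemma outer_mult: "outer v f ** A = outer v (f v* A)"
  by (simp add: outer_def matrix_matrix_mult_def vector_matrix_mult_def vec_eq_iff
      sum_distrib_left mult.assoc)

lemma outer_mult_vec: "outer v f *v x = dot f x *s v"
  by (simp add: outer_def dot_def matrix_vector_mult_def vec_eq_iff sum_distrib_left
      sum_distrib_right mult_ac)

lemma outer_mult_outer: "outer v f ** outer w g = outer (dot f w *s v) g"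
  by (simp add: mult_outer outer_mult_vec)

lemma outer_scale: "outer (c *s v) (f :: 'a::field ^ 'n) = mat c ** outer (v :: 'a ^ 'n) f"
proof -
  have "outer (c *s v) f $ i $ j = (mat c ** outer v f) $ i $ j" for i j
    by (simp only: mat_mult_left) (simp add: outer_def mult_ac)
  then show ?thesis by (simp only: vec_eq_iff) blast
qed

lemma outer_eq_0_iff: "outer v f = 0 \<longleftrightarrow> v = 0 \<or> f = 0"
  by (auto simp: outer_def vec_eq_iff)

text \<open>A column where \<open>f\<close> does not vanish exhibits \<open>w\<close> as a multiple
  of \<open>v\<close>; a row where \<open>v\<close> does not vanish does the same for
  \<open>g\<close> and \<open>f\<close>.\<close>

lemma outer_eq_parallel:
  assumes eq: "outer v f = outer w g" and "v \<noteq> 0" "f \<noteq> 0"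
  shows "\<exists>c. w = c *s v" "\<exists>c. g = c *s f"
proof -
  obtain i j where i: "v $ i \<noteq> 0" and j: "f $ j \<noteq> 0"
    using assms(2,3) by (auto simp: vec_eq_iff)
  have e: "v $ k * f $ l = w $ k * g $ l" for k l
    using eq by (simp add: outer_def vec_eq_iff)
  have wi: "w $ i \<noteq> 0" and gj: "g $ j \<noteq> 0" using e[of i j] i j by auto
  have "w $ k = f $ j / g $ j * v $ k" for k using e[of k j] gj by (simp add: field_simps)
  then show "\<exists>c. w = c *s v" by (intro exI[of _ "f $ j / g $ j"]) (simp add: vec_eq_iff)
  have "g $ l = v $ i / w $ i * f $ l" for l using e[of i l] wi by (simp add: field_simps)
  then show "\<exists>c. g = c *s f" by (intro exI[of _ "v $ i / w $ i"]) (simp add: vec_eq_iff)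
qed

lemma mat_mult_vec: "mat c *v x = c *s (x :: 'a::field ^ 'n)"
  by (simp add: matrix_vector_mult_def mat_def vec_eq_iff if_distrib[where f="\<lambda>a. a * _"] cong: if_cong)

lemma vec_mult_mat: "x v* mat c = c *s (x :: 'a::field ^ 'n)"
  by (simp add: vector_matrix_mult_def mat_def vec_eq_iff if_distrib[where f="\<lambda>a. _ * a"] mult.commute cong: if_cong)

lemma dot_swap: "dot (f v* A) x = dot f (A *v x)"
  by (simp add: dot_def vector_matrix_mult_def matrix_vector_mult_def sum_distrib_left
      sum_distrib_right mult.assoc) (rule sum.swap)

lemma mult_axis: "A *v axis k 1 = column k (A :: 'a::field ^ 'n ^ 'm)"
  by (simp add: matrix_vector_mult_def axis_def column_def vec_eq_iff
      if_distrib[where f="\<lambda>a. _ * a"] cong: if_cong)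

lemma matrix_eqI: "(\<And>x. A *v x = B *v x) \<Longrightarrow> A = (B :: 'a::field ^ 'n ^ 'm)"
  by (simp add: matrix_eq)

lemma exists_not_in_span2: "\<exists>z. z \<notin> vec.span {x, y :: 'a::field ^ 3}"
proof (rule ccontr)
  assume "\<nexists>z. z \<notin> vec.span {x, y}"
  then have "vec.span {x, y} = UNIV" by blast
  then have "CARD(3) = vec.dim (vec.span {x, y})" by (simp only: vec_dim_card)
  also have "\<dots> \<le> card {x, y}" using vec.dim_le_card[of "vec.span {x, y}" "{x, y}"] by simp
  also have "\<dots> \<le> 2" by (simp add: card_insert_if)
  finally show False by simp
qed

lemma span3:
  fixes x y z v :: "'a::field ^ 3"
  assumes "x \<noteq> 0" "y \<notin> vec.span {x}" "z \<notin> vec.span {x, y}"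
  shows "\<exists>a b c. v = a *s x + b *s y + c *s z"
proof -
  have ind: "vec.independent {z, y, x}"
    using assms by (intro vec.independent_insertI) (auto simp: insert_commute vec.independent_empty)
  have "y \<noteq> x" "z \<noteq> x" "z \<noteq> y" using assms vec.span_base by blast+
  then have "card {z, y, x} = 3" by simp
  then have "UNIV \<subseteq> vec.span {z, y, x}"
    using ind by (intro vec.card_ge_dim_independent) (auto simp: card_cart_basis)
  then have "v \<in> vec.span {z, y, x}" by blast
  then obtain c b where "v - c *s z - b *s y \<in> vec.span {x}"
    by (auto simp: vec.span_breakdown_eq)
  then obtain a where "v - c *s z - b *s y = a *s x" by (auto simp: vec.span_singleton)
  then have "v = a *s x + b *s y + c *s z" by (simp add: algebra_simps)
  then show ?thesis by blast
qed

lemma all_eigen_imp_scalar: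
  fixes A :: "'a::field ^ 'n ^ 'n"
  assumes "\<And>x. \<exists>c. A *v x = c *s x"
  shows "\<exists>c. A = mat c"
proof -
  obtain c where c: "\<And>x. A *v x = c x *s x" using assms by metis
  have e: "A $ k $ i = (if k = i then c (axis i 1) else 0)" for i k
    using arg_cong[OF c[of "axis i 1"], of "\<lambda>x. x $ k"]
    by (simp only: mult_axis) (simp add: column_def axis_def)
  \<comment> \<open>The sum of two basis vectors is an eigenvector as well, which forces their
    eigenvalues to coincide.\<close>
  have "c (axis i 1) = c (axis j 1)" for i j
  proof (cases "i = j")
    case False
    have "A *v (axis i 1 + axis j 1) = c (axis i 1) *s axis i 1 + c (axis j 1) *s axis j 1"
      by (simp add: matrix_vector_right_distrib c)
    then have *: "c (axis i 1 + axis j 1) *s (axis i 1 + axis j 1) = c (axis i 1) *s axis i 1 + c (axis j 1) *s axis j 1"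
      by (simp add: c)
    from arg_cong[OF *, of "\<lambda>x. x $ i"] arg_cong[OF *, of "\<lambda>x. x $ j"] False
    show ?thesis by (simp add: axis_def)
  qed simp
  then have "A = mat (c (axis undefined 1))" by (auto simp: vec_eq_iff mat_def e)
  then show ?thesis ..
qed

definition cyclic_vector :: "'a::field ^ 3 ^ 3 \<Rightarrow> 'a ^ 3 \<Rightarrow> bool" where
  "cyclic_vector s z \<longleftrightarrow> (\<forall>y. \<exists>a b c. y = a *s z + b *s (s *v z) + c *s (s *v (s *v z)))"

text \<open>A matrix commuting with \<open>s\<close> is determined by its value at \<open>z\<close>,
  and that value is a polynomial in \<open>s\<close> applied to \<open>z\<close>. Hence
  \<open>A ** B\<close> and \<open>B ** A\<close> agree at \<open>z\<close>, and then on the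
  spanning vectors.\<close>

lemma cyclic_imp_centralizer_abelian:
  fixes s A B :: "'a::field ^ 3 ^ 3"
  assumes z: "cyclic_vector s z" and A: "A ** s = s ** A" and B: "B ** s = s ** B"
  shows "A ** B = B ** A"
proof -
  have comm: "X *v (s *v x) = s *v (X *v x)" if "X ** s = s ** X" for X x
    using that by (simp add: matrix_vector_mul_assoc)
  note lin = matrix_vector_right_distrib vector_scalar_commute
  obtain a b c where a: "A *v z = a *s z + b *s (s *v z) + c *s (s *v (s *v z))"
    using z unfolding cyclic_vector_def by blast
  obtain a' b' c' where b: "B *v z = a' *s z + b' *s (s *v z) + c' *s (s *v (s *v z))"
    using z unfolding cyclic_vector_def by blast
  have "A *v (B *v z) = a' *s (A *v z) + b' *s (s *v (A *v z)) + c' *s (s *v (s *v (A *v z)))"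
    unfolding b by (simp only: lin comm[OF A])
  also have "\<dots> = a *s (B *v z) + b *s (s *v (B *v z)) + c *s (s *v (s *v (B *v z)))"
    unfolding a b by (simp add: lin vec_eq_iff algebra_simps)
  also have "\<dots> = B *v (A *v z)" unfolding a by (simp only: lin comm[OF B])
  finally have AB: "A *v (B *v z) = B *v (A *v z)" .
  show ?thesis
  proof (rule matrix_eqI)
    fix y
    obtain p q r where y: "y = p *s z + q *s (s *v z) + r *s (s *v (s *v z))"
      using z unfolding cyclic_vector_def by blast
    show "(A ** B) *v y = (B ** A) *v y"
      unfolding y by (simp only: lin comm[OF A] comm[OF B] AB matrix_vector_mul_assoc[symmetric])
  qed
qed

text \<open>Take a plane \<open>W\<close> spanned by \<open>x\<close> and \<open>s x\<close>, which is invariant since \<open>x\<close> is not cyclic, and let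
  \<open>s\<close> act by \<open>\<mu>\<close> on the quotient by \<open>W\<close>. Any \<open>z\<close> outside \<open>W\<close> for which \<open>s z - \<mu> z\<close> is a nonzero multiple of
  \<open>x\<close> would be cyclic; excluding two such vectors \<open>z\<close> forces \<open>s - \<mu>\<close> to have rank at most one. This works
  over every field, however small.\<close>

lemma no_cyclic_imp_rank_one:
  fixes s :: "'a::field ^ 3 ^ 3"
  assumes nc: "\<And>z. \<not> cyclic_vector s z"
  shows "\<exists>l v f. s = mat l + outer v f"
proof (cases "\<forall>x. \<exists>c. s *v x = c *s x")
  case True
  then obtain c where "s = mat c" using all_eigen_imp_scalar by blast
  then have "s = mat c + outer 0 0" by (simp add: outer_eq_0_iff)
  then show ?thesis by blast
next
  case False
  note lin = matrix_vector_right_distrib vector_scalar_commute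
  obtain x where x: "\<And>c. s *v x \<noteq> c *s x" using False by blast
  have x0: "x \<noteq> 0" using x[of 0] by auto
  have sx: "s *v x \<notin> vec.span {x}" using x by (auto simp: vec.span_singleton)
  have "s *v (s *v x) \<in> vec.span {x, s *v x}"
  proof (rule ccontr)
    assume "s *v (s *v x) \<notin> vec.span {x, s *v x}"
    from span3[OF x0 sx this] nc[of x] show False unfolding cyclic_vector_def by blast
  qed
  then obtain b a where ssx: "s *v (s *v x) = a *s (s *v x) + b *s x"
    by (auto simp: insert_commute[of x] vec.span_breakdown_eq[of _ "s *v x"] vec.span_singleton algebra_simps)
  obtain y where y: "y \<notin> vec.span {x, s *v x}" using exists_not_in_span2 by blast
  note basis = span3[OF x0 sx y]
  obtain \<alpha> \<beta> \<mu> where sy: "s *v y = \<alpha> *s x + \<beta> *s (s *v x) + \<mu> *s y" using basis by blast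
  \<comment> \<open>The relation recovers \<open>x\<close> from \<open>z\<close> and
    \<open>s *v z\<close>, hence also \<open>s *v x\<close> and \<open>y\<close>, so
    \<open>z\<close> would be cyclic.\<close>
  have key: False if z: "s *v z = \<mu> *s z + \<kappa> *s x" "\<kappa> \<noteq> 0" "z = y + \<xi> *s x + \<eta> *s (s *v x)"
    for z \<kappa> \<xi> \<eta>
  proof -
    have "s *v z - \<mu> *s z = \<kappa> *s x" using z(1) by simp
    then have "x = (1 / \<kappa>) *s (s *v z - \<mu> *s z)" using z(2) by simp
    then have x': "x = (1 / \<kappa>) *s (s *v z) + (- \<mu> / \<kappa>) *s z" by (simp add: vec_eq_iff algebra_simps)
    have sx': "s *v x = (1 / \<kappa>) *s (s *v (s *v z)) + (- \<mu> / \<kappa>) *s (s *v z)"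
      by (subst x') (simp only: lin)
    have y': "y = z - \<xi> *s x - \<eta> *s (s *v x)" using z(3) by simp
    have "cyclic_vector s z" unfolding cyclic_vector_def
    proof
      fix w
      obtain p q r where w: "w = p *s x + q *s (s *v x) + r *s y" using basis by blast
      have "w = r *s z + (p - r * \<xi>) *s x + (q - r * \<eta>) *s (s *v x)"
        unfolding w y' by (simp add: vec_eq_iff algebra_simps)
      also have "\<dots> = (r + (p - r * \<xi>) * (- \<mu> / \<kappa>)) *s z
          + ((p - r * \<xi>) / \<kappa> + (q - r * \<eta>) * (- \<mu> / \<kappa>)) *s (s *v z) + ((q - r * \<eta>) / \<kappa>) *s (s *v (s *v z))"
        unfolding sx' by (subst x') (simp add: vec_eq_iff algebra_simps diff_divide_distrib)
      finally show "\<exists>a b c. w = a *s z + b *s (s *v z) + c *s (s *v (s *v z))" by blast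
    qed
    with nc show False by blast
  qed
  have su: "s *v (y + \<xi> *s x + \<eta> *s (s *v x)) = \<mu> *s (y + \<xi> *s x + \<eta> *s (s *v x))
      + (\<alpha> + b * \<eta> - \<mu> * \<xi>) *s x + (\<beta> + \<xi> + a * \<eta> - \<mu> * \<eta>) *s (s *v x)" for \<xi> \<eta>
    unfolding lin sy ssx by (simp add: vec_eq_iff algebra_simps)
  have p0: "b = \<mu>\<^sup>2 - a * \<mu>"
  proof (rule ccontr)
    assume ne: "b \<noteq> \<mu>\<^sup>2 - a * \<mu>"
    \<comment> \<open>\<xi> makes the coefficient of \<open>s *v x\<close> in \<open>su\<close>
      vanish and \<eta> makes that of \<open>x\<close> equal to 1. The denominator is minus the
      characteristic polynomial of \<open>s\<close> on the plane, taken at \<mu>; so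
      \<open>p0\<close> says that \<mu> is an eigenvalue there.\<close>
    define \<eta> where "\<eta> = (1 - \<alpha> - \<mu> * \<beta>) / (b - \<mu>\<^sup>2 + a * \<mu>)"
    define \<xi> where "\<xi> = \<mu> * \<eta> - \<beta> - a * \<eta>"
    have ne': "b - \<mu>\<^sup>2 + a * \<mu> \<noteq> 0" using ne by (auto simp: algebra_simps)
    then have "\<eta> * (b - \<mu>\<^sup>2 + a * \<mu>) = 1 - \<alpha> - \<mu> * \<beta>" by (simp add: \<eta>_def)
    then have 1: "\<alpha> + b * \<eta> - \<mu> * \<xi> = 1" unfolding \<xi>_def by (simp add: power2_eq_square algebra_simps)
    have 2: "\<beta> + \<xi> + a * \<eta> - \<mu> * \<eta> = 0" by (simp add: \<xi>_def)
    from su[of \<xi> \<eta>] show False unfolding 1 2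
      by (intro key[of "y + \<xi> *s x + \<eta> *s (s *v x)" 1 \<xi> \<eta>]) simp_all
  qed
  have \<alpha>: "\<alpha> = - \<mu> * \<beta>"
  proof (rule ccontr)
    assume ne: "\<alpha> \<noteq> - \<mu> * \<beta>"
    then have "\<alpha> + \<mu> * \<beta> \<noteq> 0" by (auto simp: add_eq_0_iff)
    with su[of "- \<beta>" 0] show False
      by (intro key[of "y + (- \<beta>) *s x + 0 *s (s *v x)" "\<alpha> + \<mu> * \<beta>" "- \<beta>" 0]) simp_all
  qed
  \<comment> \<open>\<open>s - mat \<mu>\<close> sends \<open>x\<close> to \<open>v\<close>; by
    \<open>p0\<close> and the relation for \<alpha> it sends \<open>s *v x\<close> and
    \<open>y\<close> to multiples of \<open>v\<close> as well.\<close>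
  define v where "v = s *v x - \<mu> *s x"
  have "\<exists>c. (s - mat \<mu>) *v w = c *s v" for w
  proof -
    obtain p q r where w: "w = p *s x + q *s (s *v x) + r *s y" using basis by blast
    have "(s - mat \<mu>) *v w = (p + q * (a - \<mu>) + r * \<beta>) *s v"
      unfolding w matrix_vector_mult_diff_rdistrib mat_mult_vec lin sy ssx v_def p0 \<alpha>
      by (simp add: vec_eq_iff algebra_simps power2_eq_square)
    then show ?thesis by blast
  qed
  then obtain c where c: "\<And>w. (s - mat \<mu>) *v w = c w *s v" by metis
  have "s - mat \<mu> = outer v (\<chi> j. c (axis j 1))"
  proof (subst vec_eq_iff, subst vec_eq_iff, intro allI)
    fix i j
    have "(s - mat \<mu>) $ i $ j = ((s - mat \<mu>) *v axis j 1) $ i"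
      by (simp add: mult_axis column_def)
    also have "\<dots> = c (axis j 1) * v $ i" by (simp only: c vector_smult_component)
    finally show "(s - mat \<mu>) $ i $ j = outer v (\<chi> j. c (axis j 1)) $ i $ j" by (simp add: outer_def)
  qed
  then have "s = mat \<mu> + outer v (\<chi> j. c (axis j 1))" by (simp add: algebra_simps)
  then show ?thesis by blast
qed

text \<open>Here \<open>D *v (D *v z)\<close> is a multiple of \<open>z\<close>, so the images of
  \<open>z\<close> span at most a plane and no vector is cyclic. The argument is independent of the
  characteristic.\<close>

lemma square_scalar_imp_rank_one:
  fixes D :: "'a::field ^ 3 ^ 3"
  assumes "D ** D = mat c"
  shows "\<exists>\<epsilon> w g. D = mat \<epsilon> + outer w g"
proof (rule no_cyclic_imp_rank_one)
  fix z
  show "\<not> cyclic_vector D z"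
  proof
    assume cyc: "cyclic_vector D z"
    have "D *v (D *v z) = c *s z" by (simp add: matrix_vector_mul_assoc assms mat_mult_vec)
    have "y \<in> vec.span {z, D *v z}" for y
    proof -
      obtain p q r where "y = p *s z + q *s (D *v z) + r *s (D *v (D *v z))"
        using cyc unfolding cyclic_vector_def by blast
      then show ?thesis unfolding \<open>D *v (D *v z) = c *s z\<close>
        by (simp add: vec.span_add vec.span_scale vec.span_base)
    qed
    then show False using exists_not_in_span2 by blast
  qed
qed

section \<open>Commutation and inversion for matrices that are scalar plus rank one\<close>

lemma mat_zero: "mat 0 = (0 :: 'a::field ^ 'n ^ 'n)"
  by (simp add: mat_def vec_eq_iff)

lemma matrix_add_rdistrib: "(B + C) ** A = B ** A + C ** (A :: 'a::field ^ 'n ^ 'm)"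
  by (simp add: matrix_matrix_mult_def vec_eq_iff algebra_simps sum.distrib)

lemma matrix_sub_rdistrib: "(B - C) ** A = B ** A - C ** (A :: 'a::field ^ 'n ^ 'm)"
  by (simp add: matrix_matrix_mult_def vec_eq_iff algebra_simps sum_subtractf)

lemma det_mat: "det (mat c :: 'a::field ^ 3 ^ 3) = c ^ 3"
  by (simp add: det_3 mat_def power3_eq_cube)

lemma matrix_left_cancel:
  fixes A :: "'a::field ^ 'n ^ 'n"
  assumes "det A \<noteq> 0" "A ** X = A ** Y"
  shows "X = Y"
proof -
  obtain B where "B ** A = mat 1"
    using assms(1) invertible_det_nz[of A] invertible_left_inverse[of A] by auto
  then have "X = B ** (A ** X)" "Y = B ** (A ** Y)" by (simp_all add: matrix_mul_assoc)
  with assms(2) show ?thesis by simp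
qed

lemma matrix_vec_cancel:
  fixes A :: "'a::field ^ 'n ^ 'n"
  assumes "det A \<noteq> 0" "A *v x = 0"
  shows "x = 0"
proof -
  obtain B where "B ** A = mat 1"
    using assms(1) invertible_det_nz[of A] invertible_left_inverse[of A] by auto
  then have "x = B *v (A *v x)" by (simp add: matrix_vector_mul_assoc)
  with assms(2) show ?thesis by simp
qed

lemma scalar_mult_cancel:
  fixes A :: "'a::field ^ 'n ^ 'n"
  assumes "det A \<noteq> 0" "mat c ** A = mat d ** A"
  shows "c = d"
proof -
  obtain B where "B ** A = mat 1"
    using assms(1) invertible_det_nz[of A] invertible_left_inverse[of A] by auto
  then have B: "A ** B = mat 1" using matrix_left_right_inverse by blast
  have "(mat c ** A) ** B = (mat d ** A) ** B" using assms(2) by simp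
  then have "(mat c :: 'a ^ 'n ^ 'n) $ i $ i = mat d $ i $ i" for i
    by (simp add: matrix_mul_assoc[symmetric] B)
  then show ?thesis by (simp add: mat_def)
qed

text \<open>The sum of two outer products factors through a matrix with zero third column, so its
  determinant vanishes. The comparisons below use this to show that a scalar coefficient is
  zero.\<close>

lemma two_outer_singular:
  fixes T :: "'a::field ^ 3 ^ 3"
  assumes "det T \<noteq> 0" "mat a ** T = outer v f + outer w g"
  shows "a = 0"
proof -
  define A :: "'a ^ 3 ^ 3" where "A = (\<chi> i j. if j = 1 then v $ i else if j = 2 then w $ i else 0)"
  define B :: "'a ^ 3 ^ 3" where "B = (\<chi> i j. if i = 1 then f $ j else if i = 2 then g $ j else 0)"
  have "outer v f + outer w g = A ** B"
    by (simp add: A_def B_def outer_def matrix_matrix_mult_def vec_eq_iff sum_3)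
  moreover have "det A = 0" by (simp add: det_3 A_def)
  ultimately have "det (outer v f + outer w g) = 0" by (simp add: det_mul)
  then have "a ^ 3 * det T = 0" using arg_cong[OF assms(2), of det] by (simp add: det_mul det_mat)
  with assms(1) show ?thesis by simp
qed

text \<open>Substituting \<open>S\<close> turns a multiple of \<open>T\<close> into a sum of two
  outer products, so that multiple is zero. As \<open>l\<close> is nonzero for invertible
  \<open>S\<close>, this gives \<open>c = 1\<close>, and the remaining equality of outer products
  makes \<open>v\<close> a right and \<open>f\<close> a left eigenvector of
  \<open>T\<close>.\<close>

lemma rank_one_commuting:
  fixes T :: "'a::field ^ 3 ^ 3"
  assumes S: "S = mat l + outer v f" and "v \<noteq> 0" "f \<noteq> 0"
    and dT: "det T \<noteq> 0" and dS: "det S \<noteq> 0" and comm: "S ** T = mat c ** (T ** S)"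
  shows "\<exists>a. T *v v = a *s v" "\<exists>b. f v* T = b *s f"
proof -
  have l0: "l \<noteq> 0"
  proof
    assume "l = 0"
    then have "mat 1 ** S = outer v f + outer 0 0" by (simp add: S outer_eq_0_iff mat_zero)
    from two_outer_singular[OF dS this] show False by simp
  qed
  have "S ** T = mat l ** T + outer v (f v* T)" by (simp add: S matrix_add_rdistrib outer_mult)
  moreover have "T ** S = mat l ** T + outer (T *v v) f"
    by (simp add: S matrix_add_ldistrib mult_outer mat_commute)
  ultimately have e: "mat l ** T + outer v (f v* T) = mat (c * l) ** T + outer (c *s (T *v v)) f"
    using comm by (simp add: matrix_add_ldistrib matrix_mul_assoc mat_mult_mat outer_scale)
  have m: "mat (l - c * l) = (mat l - mat (c * l) :: 'a ^ 3 ^ 3)" by (simp add: mat_def vec_eq_iff)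
  have neg: "outer (- v) g = - outer v g" for v g :: "'a ^ 3" by (simp add: outer_def vec_eq_iff)
  have "mat (l - c * l) ** T = outer (c *s (T *v v)) f + outer (- v) (f v* T)"
    using e unfolding m neg by (simp add: matrix_sub_rdistrib algebra_simps)
  then have "l - c * l = 0" by (rule two_outer_singular[OF dT])
  then have c: "c = 1" using l0 by simp
  have "outer v (f v* T) = outer (T *v v) f" using e c by simp
  moreover have "f v* T \<noteq> 0"
    using matrix_vec_cancel[of "transpose T" f] dT \<open>f \<noteq> 0\<close> by (auto simp: det_transpose)
  ultimately obtain b where b: "T *v v = b *s v" and "\<exists>d. f = d *s (f v* T)"
    using outer_eq_parallel[of v "f v* T" "T *v v" f] \<open>v \<noteq> 0\<close> by blast
  then obtain d where d: "f = d *s (f v* T)" by blast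
  then have "d \<noteq> 0" using \<open>f \<noteq> 0\<close> by auto
  have "f v* T = (1 / d) *s f" by (subst (2) d) (use \<open>d \<noteq> 0\<close> in simp)
  then show "\<exists>b. f v* T = b *s f" by blast
  show "\<exists>a. T *v v = a *s v" using b by blast
qed

text \<open>The same comparison gives \<open>c = l * l\<close> and the eigenvectors. Evaluating the
  remaining identity at \<open>v\<close> shows that \<open>dot f v\<close> is 0 or
  \<open>- 2 * l\<close>; in the second case the rank one part of \<open>S ** S\<close> has
  coefficient \<open>l + l + dot f v = 0\<close>.\<close>

lemma rank_one_inverted:
  fixes T :: "'a::field ^ 3 ^ 3"
  assumes S: "S = mat l + outer v f" and "v \<noteq> 0" "f \<noteq> 0"
    and dT: "det T \<noteq> 0" and dS: "det S \<noteq> 0" and inv: "S ** T ** S = mat c ** T"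
  shows "\<exists>a. T *v v = a *s v" "\<exists>b. f v* T = b *s f" "dot f v = 0 \<or> S ** S = mat (l\<^sup>2)"
proof -
  have l0: "l \<noteq> 0"
  proof
    assume "l = 0"
    then have "mat 1 ** S = outer v f + outer 0 0" by (simp add: S outer_eq_0_iff mat_zero)
    from two_outer_singular[OF dS this] show False by simp
  qed
  have add: "outer x g + outer x h = outer x (g + h)" for x g h :: "'a ^ 3"
    by (simp add: outer_def vec_eq_iff algebra_simps)
  have scale: "mat k ** outer x g = outer x (k *s g)" for k and x g :: "'a ^ 3"
    by (simp add: outer_scale[symmetric]) (simp add: outer_def vec_eq_iff)
  define \<gamma> where "\<gamma> = dot f (T *v v)"
  have ST: "S ** T = mat l ** T + outer v (f v* T)"
    by (simp add: S matrix_add_rdistrib outer_mult)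
  have TS: "T ** S = mat l ** T + outer (T *v v) f"
    by (simp add: S matrix_add_ldistrib mult_outer mat_commute)
  have "outer v (f v* T) ** S = outer v (f v* T) ** mat l + outer v (f v* T) ** outer v f"
    by (simp add: S matrix_add_ldistrib)
  also have "outer v (f v* T) ** outer v f = outer v (\<gamma> *s f)"
    by (simp add: outer_mult_outer dot_swap \<gamma>_def outer_scale scale)
  also have "outer v (f v* T) ** mat l = outer v (l *s (f v* T))"
    by (simp add: outer_mult vec_mult_mat)
  finally have "outer v (f v* T) ** S = outer v (l *s (f v* T)) + outer v (\<gamma> *s f)" .
  moreover have "mat l ** T ** S = mat (l * l) ** T + outer (l *s (T *v v)) f"
    by (simp only: matrix_mul_assoc[symmetric] TS)
      (simp add: matrix_add_ldistrib matrix_mul_assoc mat_mult_mat outer_scale)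
  ultimately have "S ** T ** S = mat (l * l) ** T + outer (l *s (T *v v)) f
      + (outer v (l *s (f v* T)) + outer v (\<gamma> *s f))"
    by (simp only: ST matrix_add_rdistrib)
  then have e: "mat c ** T = mat (l * l) ** T + outer v (l *s (f v* T) + \<gamma> *s f) + outer (l *s (T *v v)) f"
    using inv by (simp add: add[symmetric] add_ac)
  have m: "mat (c - l * l) = (mat c - mat (l * l) :: 'a ^ 3 ^ 3)" by (simp add: mat_def vec_eq_iff)
  have neg: "outer (- v) g = - outer v g" for v g :: "'a ^ 3" by (simp add: outer_def vec_eq_iff)
  have "mat (c - l * l) ** T = outer v (l *s (f v* T) + \<gamma> *s f) + outer (l *s (T *v v)) f"
    using e unfolding m by (simp add: matrix_sub_rdistrib)
  then have "c - l * l = 0" by (rule two_outer_singular[OF dT])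
  then have 1: "outer (- (l *s (T *v v))) f = outer v (l *s (f v* T) + \<gamma> *s f)"
    using e unfolding neg by (simp add: neg_eq_iff_add_eq_0 add.commute)
  have Tv: "T *v v \<noteq> 0" using matrix_vec_cancel[OF dT, of v] \<open>v \<noteq> 0\<close> by blast
  then have "- (l *s (T *v v)) \<noteq> 0" using l0 by simp
  from outer_eq_parallel[OF 1 this \<open>f \<noteq> 0\<close>] obtain a b
    where a: "v = a *s (- (l *s (T *v v)))" and b: "l *s (f v* T) + \<gamma> *s f = b *s f" by blast
  have "a \<noteq> 0" using a \<open>v \<noteq> 0\<close> by auto
  have Ta: "T *v v = (- 1 / (a * l)) *s v" by (subst (2) a) (use \<open>a \<noteq> 0\<close> l0 in \<open>simp add: vec_eq_iff\<close>)
  then show "\<exists>a. T *v v = a *s v" by blast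
  have "l *s (f v* T) = (b - \<gamma>) *s f" using b by (simp add: algebra_simps)
  then have "(1 / l) *s (l *s (f v* T)) = ((b - \<gamma>) / l) *s f" by (simp only:) simp
  then show "\<exists>b. f v* T = b *s f" using l0 by auto
  define \<alpha> where "\<alpha> = - 1 / (a * l)"
  have \<alpha>0: "\<alpha> \<noteq> 0" using \<open>a \<noteq> 0\<close> l0 by (simp add: \<alpha>_def)
  have Ta: "T *v v = \<alpha> *s v" using Ta by (simp add: \<alpha>_def)
  have g: "\<gamma> = \<alpha> * dot f v" by (simp add: \<gamma>_def Ta dot_def sum_distrib_left mult_ac)
  show "dot f v = 0 \<or> S ** S = mat (l\<^sup>2)"
  proof (cases "dot f v = 0")
    case False
    have "dot (l *s (f v* T) + \<gamma> *s f) v *s v = outer v (l *s (f v* T) + \<gamma> *s f) *v v"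
      by (simp add: outer_mult_vec)
    also have "\<dots> = - (l * \<alpha> * dot f v) *s v"
      unfolding 1[symmetric] outer_mult_vec Ta by (simp add: vec_eq_iff)
    finally have "dot (l *s (f v* T) + \<gamma> *s f) v = - (l * \<alpha> * dot f v)"
      using \<open>v \<noteq> 0\<close> by (simp only: vec.scale_right_imp_eq vec.scale_cancel_right) simp
    moreover have "dot (l *s (f v* T) + \<gamma> *s f) v = l * dot (f v* T) v + \<gamma> * dot f v"
      by (simp add: dot_def sum_distrib_left sum.distrib algebra_simps)
    ultimately have "l * \<gamma> + \<gamma> * dot f v = - (l * \<alpha> * dot f v)" by (simp add: dot_swap \<gamma>_def)
    then have "(\<alpha> * dot f v) * (l + dot f v + l) = 0" by (simp add: g algebra_simps)
    then have d: "l + l + dot f v = 0" using \<alpha>0 False by (simp add: add_ac)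
    have "mat l ** S = mat (l * l) + outer (l *s v) f"
      by (simp add: S matrix_add_ldistrib mat_mult_mat outer_scale)
    moreover have "outer v f ** S = outer v (l *s f) + outer (dot f v *s v) f"
      by (simp add: S matrix_add_ldistrib outer_mult_outer) (simp add: outer_mult vec_mult_mat)
    moreover have "S ** S = mat l ** S + outer v f ** S"
      by (subst (1) S) (rule matrix_add_rdistrib)
    ultimately have "S ** S = mat (l * l) + outer v ((l + l + dot f v) *s f)"
      by (simp add: outer_def vec_eq_iff algebra_simps)
    then have "S ** S = mat (l\<^sup>2)" by (simp only: d) (simp add: outer_eq_0_iff power2_eq_square)
    then show ?thesis ..
  qed simp
qed

text \<open>If \<open>v\<close> and \<open>w\<close> are independent, the functionals vanishing on
  both form a line, because the space has dimension three.\<close>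

lemma annihilator_parallel:
  fixes v w f g :: "'a::field ^ 3"
  assumes "v \<noteq> 0" "f \<noteq> 0" "dot f v = 0" "dot f w = 0" "dot g v = 0" "dot g w = 0"
  shows "(\<exists>c. w = c *s v) \<or> (\<exists>c. g = c *s f)"
proof (rule disjCI)
  assume ng: "\<nexists>c. g = c *s f"
  show "\<exists>c. w = c *s v"
  proof (rule ccontr)
    assume nw: "\<nexists>c. w = c *s v"
    then have w: "w \<notin> vec.span {v}" by (auto simp: vec.span_singleton)
    obtain z where z: "z \<notin> vec.span {v, w}" using exists_not_in_span2 by blast
    have add: "dot h (x + y) = dot h x + dot h y" and scale: "dot h (a *s x) = a * dot h x"
      for h x y :: "'a ^ 3" and a
      by (simp_all add: dot_def algebra_simps sum.distrib sum_distrib_left)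
    have ax: "dot h (axis i 1) = h $ i" for h :: "'a ^ 3" and i
      by (simp add: dot_def axis_def if_distrib[where f="\<lambda>a. _ * a"] cong: if_cong)
    have fz: "dot f z \<noteq> 0"
    proof
      assume "dot f z = 0"
      have "dot f x = 0" for x
        using span3[OF assms(1) w z, of x] assms \<open>dot f z = 0\<close> by (auto simp: add scale)
      then have "f = 0" using ax[of f] by (simp add: vec_eq_iff)
      with assms show False by simp
    qed
    have "dot g x = (dot g z / dot f z) * dot f x" for x
      using span3[OF assms(1) w z, of x] assms fz by (auto simp: add scale)
    from this[of "axis i 1" for i] have "g = (dot g z / dot f z) *s f"
      unfolding ax by (simp add: vec_eq_iff)
    with ng show False by blast
  qed
qed

text \<open>\<open>w\<close> spans the image of \<open>D - mat e\<close>, which every matrix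
  commuting with \<open>D\<close> preserves.\<close>

lemma outer_commute_eigen:
  fixes A :: "'a::field ^ 3 ^ 3"
  assumes D: "D = mat e + outer w g" and "w \<noteq> 0" "g \<noteq> 0" and det: "det A \<noteq> 0"
    and comm: "D ** A = A ** D"
  shows "\<exists>k. k \<noteq> 0 \<and> A *v w = k *s w"
proof -
  have "mat e ** A + outer w (g v* A) = mat e ** A + outer (A *v w) g"
    using comm by (simp add: D matrix_add_ldistrib matrix_add_rdistrib mult_outer outer_mult mat_commute)
  then have eq: "outer w (g v* A) = outer (A *v w) g" by simp
  have "A *v w \<noteq> 0" using matrix_vec_cancel[OF det] \<open>w \<noteq> 0\<close> by blast
  moreover obtain c where c: "w = c *s (A *v w)"
    using outer_eq_parallel(1)[OF eq[symmetric]] \<open>A *v w \<noteq> 0\<close> \<open>g \<noteq> 0\<close> by blast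
  ultimately have "c \<noteq> 0" using \<open>w \<noteq> 0\<close> by auto
  have "(1 / c) *s w = A *v w" by (subst c) (use \<open>c \<noteq> 0\<close> in simp)
  then show ?thesis using \<open>c \<noteq> 0\<close> by (intro exI[of _ "1 / c"]) simp
qed

section \<open>Eigenbases and the invariant form\<close>

lemma columns_inverse:
  fixes F1 F2 F3 :: "'a::field ^ 3"
  assumes ind: "\<And>a b c. a *s F1 + b *s F2 + c *s F3 = 0 \<Longrightarrow> a = 0 \<and> b = 0 \<and> c = 0"
  obtains C C' :: "'a ^ 3 ^ 3" where "C ** C' = mat 1" "C' ** C = mat 1"
    "C *v axis 1 1 = F1" "C *v axis 2 1 = F2" "C *v axis 3 1 = F3"
proof -
  define C :: "'a ^ 3 ^ 3" where "C = (\<chi> i j. if j = 1 then F1 $ i else if j = 2 then F2 $ i else F3 $ i)"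
  have Cx: "C *v x = x $ 1 *s F1 + x $ 2 *s F2 + x $ 3 *s F3" for x
    by (simp add: C_def matrix_vector_mult_def vec_eq_iff sum_3 mult.commute)
  have "x = 0" if "C *v x = 0" for x
  proof -
    have "x $ 1 = 0 \<and> x $ 2 = 0 \<and> x $ 3 = 0" using that by (intro ind) (simp only: Cx)
    then show ?thesis by (simp add: vec_eq_iff forall_3)
  qed
  then obtain C' where C': "C' ** C = mat 1" using matrix_left_invertible_ker by blast
  then have "C ** C' = mat 1" using matrix_left_right_inverse by blast
  then show ?thesis using C' by (intro that[of C C'])
    (auto simp: mult_axis column_def C_def vec_eq_iff)
qed

lemma third_root_facts:
  fixes \<omega> :: "'a::field"
  assumes "\<omega> ^ 3 = 1" "\<omega> \<noteq> 1"
  shows "\<omega>\<^sup>2 \<noteq> 1" "\<omega>\<^sup>2 \<noteq> \<omega>" "\<omega> \<noteq> 0" "\<omega>\<^sup>2 + \<omega> + 1 = 0"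
proof -
  have 3: "\<omega> * \<omega> * \<omega> = 1" using assms(1) by (simp add: power3_eq_cube)
  show "\<omega> \<noteq> 0" using 3 by auto
  then show "\<omega>\<^sup>2 \<noteq> \<omega>" using assms(2) by (simp add: power2_eq_square)
  show "\<omega>\<^sup>2 \<noteq> 1" using 3 assms(2) by (auto simp: power2_eq_square)
  have "(\<omega> - 1) * (\<omega>\<^sup>2 + \<omega> + 1) = \<omega> * \<omega> * \<omega> - 1" by (simp add: power2_eq_square algebra_simps)
  then show "\<omega>\<^sup>2 + \<omega> + 1 = 0" using 3 assms(2) by simp
qed

lemma eigen_independent:
  fixes A :: "'a::field ^ 3 ^ 3"
  assumes "A *v x = k1 *s x" "A *v y = k2 *s y" "A *v z = k3 *s z"
    and "x \<noteq> 0" "y \<noteq> 0" "z \<noteq> 0" and "k1 \<noteq> k2" "k1 \<noteq> k3" "k2 \<noteq> k3"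
    and 0: "a *s x + b *s y + c *s z = 0"
  shows "a = 0 \<and> b = 0 \<and> c = 0"
proof -
  have 1: "(a * k1) *s x + (b * k2) *s y + (c * k3) *s z = 0"
    using arg_cong[OF 0, of "\<lambda>v. A *v v"] assms(1-3)
    by (simp add: matrix_vector_right_distrib vector_scalar_commute)
  have 2: "(a * k1 * k1) *s x + (b * k2 * k2) *s y + (c * k3 * k3) *s z = 0"
    using arg_cong[OF 1, of "\<lambda>v. A *v v"] assms(1-3)
    by (simp add: matrix_vector_right_distrib vector_scalar_commute)
  have "(a * (k1 - k2) * (k1 - k3)) * x $ i = 0"
       "(b * (k2 - k1) * (k2 - k3)) * y $ i = 0"
       "(c * (k3 - k1) * (k3 - k2)) * z $ i = 0" for i
  proof -
    have e: "a * x $ i + b * y $ i + c * z $ i = 0"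
      "a * k1 * x $ i + b * k2 * y $ i + c * k3 * z $ i = 0"
      "a * k1 * k1 * x $ i + b * k2 * k2 * y $ i + c * k3 * k3 * z $ i = 0"
      using 0 1 2 by (simp_all add: vec_eq_iff)
    \<comment> \<open>The multipliers are the coefficients of \<open>(X - k2) * (X - k3)\<close>,
      which at \<open>A\<close> kills \<open>y\<close> and \<open>z\<close> and isolates
      \<open>x\<close>. The next two combinations isolate \<open>y\<close> and
      \<open>z\<close>.\<close>
    have "P + (- k2 - k3) * Q + k2 * k3 * R = 0" if "P = 0" "Q = 0" "R = 0" for P Q R :: 'a
      using that by simp
    from this[OF e(3,2,1)] show "(a * (k1 - k2) * (k1 - k3)) * x $ i = 0" by (simp add: algebra_simps)
    have "P + (- k1 - k3) * Q + k1 * k3 * R = 0" if "P = 0" "Q = 0" "R = 0" for P Q R :: 'a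
      using that by simp
    from this[OF e(3,2,1)] show "(b * (k2 - k1) * (k2 - k3)) * y $ i = 0" by (simp add: algebra_simps)
    have "P + (- k1 - k2) * Q + k1 * k2 * R = 0" if "P = 0" "Q = 0" "R = 0" for P Q R :: 'a
      using that by simp
    from this[OF e(3,2,1)] show "(c * (k3 - k1) * (k3 - k2)) * z $ i = 0" by (simp add: algebra_simps)
  qed
  moreover obtain i j l where "x $ i \<noteq> 0" "y $ j \<noteq> 0" "z $ l \<noteq> 0"
    using assms(4-6) by (auto simp: vec_eq_iff)
  ultimately show ?thesis using assms(7-9) by (metis mult_eq_0_iff right_minus_eq)
qed

text \<open>In the intended application \<open>s1\<close> and \<open>s5\<close> lift commuting elements without commuting themselves,
  and \<open>D\<close>, \<open>D4\<close>, \<open>t\<close> lift \<open>\<tau>\<^sub>1\<^sub>2\<close>, \<open>\<tau>\<^sub>4\<^sub>5\<close>, \<open>\<tau>\<^sub>1\<^sub>5\<close>. There is an eigenbasis of \<open>s5\<close>, containing the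
  distinguished eigenvector of \<open>D\<close>, whose sum is the distinguished eigenvector of \<open>D4\<close>. In it \<open>s1\<close> is a
  multiple of a cyclic permutation matrix, \<open>D\<close> is diagonal, \<open>D4\<close> is symmetric and \<open>t\<close> is a multiple of a
  transposition, so the form for which the basis is orthonormal has the required properties.\<close>

lemma invariant_form:
  fixes s1 s5 D D4 t :: "'a::field ^ 3 ^ 3"
  assumes det: "det s1 \<noteq> 0" "det s5 \<noteq> 0" "det t \<noteq> 0"
    and \<omega>: "s1 ** s5 = mat \<omega> ** (s5 ** s1)" "\<omega> \<noteq> 1" "\<omega> ^ 3 = 1"
    and D: "D ** D = mat d" "D ** s5 = s5 ** D" "\<nexists>c. D = mat c"
    and D4: "D4 ** D4 = mat d4" "D4 ** s1 = s1 ** D4" "\<nexists>c. D4 = mat c"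
    and t: "s5 ** t ** s5 = mat c ** t" "D ** t = t ** D" "D4 ** t = t ** D4"
  obtains M where "det M \<noteq> 0" "\<And>X. X \<in> {s1, D, D4, t} \<Longrightarrow> \<exists>x. X ** M ** transpose X = mat x ** M"
    "s5 ** M = M ** transpose s5"
proof -
  obtain \<epsilon> w g where Dw: "D = mat \<epsilon> + outer w g" using square_scalar_imp_rank_one[OF D(1)] by blast
  have wg: "w \<noteq> 0" "g \<noteq> 0" using D(3) Dw outer_eq_0_iff[of w g] by auto
  obtain \<epsilon>' u h where Du: "D4 = mat \<epsilon>' + outer u h" using square_scalar_imp_rank_one[OF D4(1)] by blast
  have uh: "u \<noteq> 0" "h \<noteq> 0" using D4(3) Du outer_eq_0_iff[of u h] by auto
  note root = third_root_facts[OF \<omega>(3,2)]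
  obtain \<kappa> where k: "\<kappa> \<noteq> 0" "s5 *v w = \<kappa> *s w"
    using outer_commute_eigen[OF Dw wg det(2) D(2)] by blast
  obtain \<alpha> where a: "\<alpha> \<noteq> 0" "t *v w = \<alpha> *s w"
    using outer_commute_eigen[OF Dw wg det(3) t(2)] by blast
  obtain \<mu> where l: "\<mu> \<noteq> 0" "s1 *v u = \<mu> *s u"
    using outer_commute_eigen[OF Du uh det(1) D4(2)] by blast
  obtain \<beta> where b: "\<beta> \<noteq> 0" "t *v u = \<beta> *s u"
    using outer_commute_eigen[OF Du uh det(3) t(3)] by blast
  have comm: "s5 *v (s1 *v x) = \<omega>\<^sup>2 *s (s1 *v (s5 *v x))" for x
  proof -
    have "s1 *v (s5 *v x) = \<omega> *s (s5 *v (s1 *v x))"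
      using arg_cong[OF \<omega>(1), of "\<lambda>A. A *v x"]
      by (simp add: matrix_vector_mul_assoc[symmetric] mat_mult_vec)
    then show ?thesis using \<omega>(3) by (simp add: power2_eq_square power3_eq_cube)
  qed
  \<comment> \<open>By \<open>comm\<close>, \<open>s1\<close> permutes the eigenlines of
    \<open>s5\<close> and multiplies the eigenvalue by \<open>\<omega>\<^sup>2\<close>. Starting
    from the common eigenvector \<open>w\<close> of \<open>D\<close> and \<open>s5\<close>, this
    yields three distinct eigenvalues, hence a basis.\<close>
  define e2 where "e2 = s1 *v w"
  define e3 where "e3 = s1 *v e2"
  have ne: "e2 \<noteq> 0" "e3 \<noteq> 0" using wg matrix_vec_cancel[OF det(1)] by (auto simp: e2_def e3_def)
  have ke: "s5 *v e2 = (\<kappa> * \<omega>\<^sup>2) *s e2" "s5 *v e3 = (\<kappa> * \<omega>) *s e3"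
  proof -
    show 2: "s5 *v e2 = (\<kappa> * \<omega>\<^sup>2) *s e2"
      by (simp add: e2_def comm k vector_scalar_commute mult.commute)
    have "\<omega>\<^sup>2 * (\<kappa> * \<omega>\<^sup>2) = \<kappa> * \<omega> * \<omega> ^ 3" by (simp add: power2_eq_square power3_eq_cube)
    then show "s5 *v e3 = (\<kappa> * \<omega>) *s e3"
      by (simp add: e3_def comm 2 vector_scalar_commute \<omega>(3))
  qed
  have dist: "\<kappa> \<noteq> \<kappa> * \<omega>\<^sup>2" "\<kappa> \<noteq> \<kappa> * \<omega>" "\<kappa> * \<omega>\<^sup>2 \<noteq> \<kappa> * \<omega>" using k \<omega>(2) root by auto
  note indep = eigen_independent[OF k(2) ke wg(1) ne dist]
  have nw: "e2 \<notin> vec.span {w}"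
  proof
    assume "e2 \<in> vec.span {w}"
    then obtain x where "e2 = x *s w" by (auto simp: vec.span_singleton)
    then have "x *s w + (-1) *s e2 + 0 *s e3 = 0" by simp
    from indep[OF this] show False by simp
  qed
  have nw3: "e3 \<notin> vec.span {w, e2}"
  proof
    assume "e3 \<in> vec.span {w, e2}"
    then obtain x y where "e3 - x *s w = y *s e2" by (auto simp: vec.span_breakdown_eq vec.span_singleton)
    then have "x *s w + y *s e2 + (-1) *s e3 = 0" by (simp add: algebra_simps)
    from indep[OF this] show False by simp
  qed
  note basis = span3[OF wg(1) nw nw3]
  obtain a1 a2 a3 where u: "u = a1 *s w + a2 *s e2 + a3 *s e3" using basis by blast
  obtain p q r where pqr: "s1 *v e3 = p *s w + q *s e2 + r *s e3" using basis by blast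
  \<comment> \<open>\<open>s1 *v e3\<close> has the same \<open>s5\<close>-eigenvalue as
    \<open>w\<close> and so lies on its line: \<open>s1\<close> permutes the three lines
    cyclically.\<close>
  have s1e3: "s1 *v e3 = p *s w"
  proof -
    have "\<omega>\<^sup>2 * (\<kappa> * \<omega>) = \<kappa> * \<omega> ^ 3" by (simp add: power2_eq_square power3_eq_cube)
    then have "s5 *v (s1 *v e3) = \<kappa> *s (s1 *v e3)"
      by (simp add: comm ke vector_scalar_commute \<omega>(3))
    then have "(p * \<kappa>) *s w + (q * (\<kappa> * \<omega>\<^sup>2)) *s e2 + (r * (\<kappa> * \<omega>)) *s e3
        = (\<kappa> * p) *s w + (\<kappa> * q) *s e2 + (\<kappa> * r) *s e3"
      unfolding pqr by (simp add: matrix_vector_right_distrib vector_scalar_commute ke k vector_add_ldistrib)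
    then have "0 *s w + (q * (\<kappa> * \<omega>\<^sup>2) - \<kappa> * q) *s e2 + (r * (\<kappa> * \<omega>) - \<kappa> * r) *s e3 = 0"
      by (simp add: vec_eq_iff algebra_simps)
    from indep[OF this] have "q = 0" "r = 0" using dist by (auto simp: mult.commute)
    then show ?thesis using pqr by simp
  qed
  have "s1 *v u = (a3 * p) *s w + a1 *s e2 + a2 *s e3"
    unfolding u by (simp add: matrix_vector_right_distrib vector_scalar_commute s1e3
        e2_def[symmetric] e3_def[symmetric])
  then have "(a3 * p - \<mu> * a1) *s w + (a1 - \<mu> * a2) *s e2 + (a2 - \<mu> * a3) *s e3 = 0"
    unfolding l unfolding u by (simp add: vec_eq_iff algebra_simps)
  from indep[OF this] have rec: "a3 * p = \<mu> * a1" "a1 = \<mu> * a2" "a2 = \<mu> * a3" by auto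
  \<comment> \<open>Since \<open>u\<close> is an eigenvector of \<open>s1\<close>, its coordinates
    determine each other cyclically, so none vanishes and the basis can be rescaled to have sum
    \<open>u\<close>.\<close>
  have a0: "a1 \<noteq> 0" "a2 \<noteq> 0" "a3 \<noteq> 0" using rec l(1) uh(1) u by auto
  define F1 where "F1 = a1 *s w"
  define F2 where "F2 = a2 *s e2"
  define F3 where "F3 = a3 *s e3"
  have s1F: "s1 *v F1 = \<mu> *s F2" "s1 *v F2 = \<mu> *s F3" "s1 *v F3 = \<mu> *s F1"
    using rec s1e3 by (simp_all add: F1_def F2_def F3_def vector_scalar_commute e2_def[symmetric] e3_def[symmetric])
  have s5F: "s5 *v F1 = \<kappa> *s F1" "s5 *v F2 = (\<kappa> * \<omega>\<^sup>2) *s F2" "s5 *v F3 = (\<kappa> * \<omega>) *s F3"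
    by (simp_all add: F1_def F2_def F3_def vector_scalar_commute k ke mult.commute)
  have tF: "t *v F1 = \<alpha> *s F1" by (simp add: F1_def vector_scalar_commute a mult.commute)
  have uF: "u = F1 + F2 + F3" by (simp add: u F1_def F2_def F3_def)
  have F0: "F1 \<noteq> 0" "F2 \<noteq> 0" "F3 \<noteq> 0" using a0 wg ne by (auto simp: F1_def F2_def F3_def)
  have ind: "a = 0 \<and> b = 0 \<and> c = 0" if "a *s F1 + b *s F2 + c *s F3 = 0" for a b c
    by (rule eigen_independent[OF s5F F0 dist that])
  obtain C C' :: "'a ^ 3 ^ 3" where C: "C ** C' = mat 1" "C' ** C = mat 1"
    "C *v axis 1 1 = F1" "C *v axis 2 1 = F2" "C *v axis 3 1 = F3"
    by (rule columns_inverse[OF ind])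
  have C'F: "C' *v F1 = axis 1 1" "C' *v F2 = axis 2 1" "C' *v F3 = axis 3 1"
    unfolding C(3-5)[symmetric] by (simp_all add: matrix_vector_mul_assoc C(2))
  define cj where "cj X = C' ** X ** C" for X :: "'a ^ 3 ^ 3"
  have XC: "X ** C = C ** cj X" for X by (simp add: cj_def matrix_mul_assoc C(1))
  have cj_mult: "cj (X ** Y) = cj X ** cj Y" for X Y
    by (simp add: cj_def) (metis C(1) matrix_mul_assoc matrix_mul_rid)
  have cj_mat: "cj (mat k) = mat k" for k
    by (simp add: cj_def mat_commute[of k C', symmetric] matrix_mul_assoc[symmetric] C(2))
  have cj_vec: "cj X *v x = C' *v (X *v (C *v x))" for X x
    by (simp add: cj_def matrix_vector_mul_assoc matrix_mul_assoc)
  have ent: "cj X $ i $ j = (cj X *v axis j 1) $ i" for X i j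
    by (simp add: mult_axis column_def)
  note ents = ent cj_vec C(3-5) vector_scalar_commute C'F
  have s1': "cj s1 $ 1 $ 1 = 0" "cj s1 $ 2 $ 1 = \<mu>" "cj s1 $ 3 $ 1 = 0"
            "cj s1 $ 1 $ 2 = 0" "cj s1 $ 2 $ 2 = 0" "cj s1 $ 3 $ 2 = \<mu>"
            "cj s1 $ 1 $ 3 = \<mu>" "cj s1 $ 2 $ 3 = 0" "cj s1 $ 3 $ 3 = 0"
    by (simp_all only: ents s1F) (simp_all add: axis_def)
  have s5': "cj s5 $ 1 $ 1 = \<kappa>" "cj s5 $ 2 $ 1 = 0" "cj s5 $ 3 $ 1 = 0"
            "cj s5 $ 1 $ 2 = 0" "cj s5 $ 2 $ 2 = \<kappa> * \<omega>\<^sup>2" "cj s5 $ 3 $ 2 = 0"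
            "cj s5 $ 1 $ 3 = 0" "cj s5 $ 2 $ 3 = 0" "cj s5 $ 3 $ 3 = \<kappa> * \<omega>"
    by (simp_all only: ents s5F) (simp_all add: axis_def)
  \<comment> \<open>Commuting with the diagonal matrix \<open>cj s5\<close>, whose diagonal entries
    are distinct, makes \<open>cj D\<close> diagonal.\<close>
  have D': "transpose (cj D) = cj D"
  proof -
    have "(cj D ** cj s5) $ i $ j = (cj s5 ** cj D) $ i $ j" for i j
      using D(2) by (simp add: cj_mult[symmetric])
    note e = this[unfolded matrix_matrix_mult_def vec_lambda_beta sum_3]
    have "cj D $ i $ j = 0" if "i \<noteq> j" for i j
      using e[of i j] that dist k(1) root \<omega>(2) exhaust_3[of i] exhaust_3[of j] by (auto simp: s5')
    then show ?thesis by (simp add: transpose_def vec_eq_iff) metis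
  qed
  have C'u: "C' *v u = vec 1"
    by (simp add: uF matrix_vector_right_distrib C'F) (simp add: vec_eq_iff axis_def forall_3)
  \<comment> \<open>In the new basis \<open>u\<close> is the all-ones vector, so the rank one part
    of \<open>cj D4\<close> is constant along each column; commuting with the cyclic matrix
    \<open>cj s1\<close> makes the columns equal.\<close>
  have D4': "transpose (cj D4) = cj D4"
  proof -
    define h' where "h' = h v* C"
    have "cj D4 = mat \<epsilon>' + outer (vec 1) h'"
      using C'u by (simp add: cj_def Du matrix_add_ldistrib matrix_add_rdistrib mult_outer outer_mult h'_def
          cj_mat[unfolded cj_def])
    then have x: "cj D4 $ i $ j = (if i = j then \<epsilon>' else 0) + h' $ j" for i j
      by (simp add: mat_def outer_def)
    have "(cj D4 ** cj s1) $ i $ j = (cj s1 ** cj D4) $ i $ j" for i j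
      using D4(2) by (simp add: cj_mult[symmetric])
    note e = this[unfolded matrix_matrix_mult_def vec_lambda_beta sum_3]
    have "h' $ 2 = h' $ 1" "h' $ 3 = h' $ 1"
      using e[of 2 1] e[of 3 2] e[of 1 3] l(1) by (auto simp: s1' x)
    then have "h' $ j = h' $ 1" for j using exhaust_3[of j] by auto
    then have "cj D4 $ i $ j = cj D4 $ j $ i" for i j by (simp add: x) metis
    then show ?thesis by (simp add: transpose_def vec_eq_iff)
  qed
  \<comment> \<open>An entry of \<open>cj t\<close> survives only if the diagonal entries of
    \<open>cj s5\<close> at its row and column multiply to \<open>c\<close>, which the corner entry
    shows to be \<open>\<kappa> * \<kappa>\<close>. This leaves the positions 11, 23 and 32, and the
    all-ones eigenvector makes the three entries equal.\<close>
  have t': "transpose (cj t) = cj t" "cj t ** cj t = mat (\<beta>\<^sup>2)"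
  proof -
    have t1: "cj t $ 1 $ 1 = \<alpha>" "cj t $ 2 $ 1 = 0" "cj t $ 3 $ 1 = 0"
      by (simp_all only: ents tF) (simp_all add: axis_def)
    have "cj s5 ** cj t ** cj s5 = mat c ** cj t" using arg_cong[OF t(1), of cj] by (simp only: cj_mult cj_mat)
    then have "(cj s5 ** cj t ** cj s5) $ i $ j = c * cj t $ i $ j" for i j by (simp only: mat_mult_left)
    note e = this[unfolded matrix_matrix_mult_def vec_lambda_beta sum_3 s5']
    have c: "c = \<kappa> * \<kappa>" using e[of 1 1] a(1) by (simp add: s5' t1)
    have "\<omega>\<^sup>2 * \<omega>\<^sup>2 = \<omega> ^ 3 * \<omega>" by (simp add: power2_eq_square power3_eq_cube)
    then have w4: "\<omega>\<^sup>2 * \<omega>\<^sup>2 = \<omega>" by (simp add: \<omega>(3))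
    have z: "cj t $ i $ j = 0" if "m * cj t $ i $ j = (\<kappa> * \<kappa>) * cj t $ i $ j" "m = \<kappa> * \<kappa> * y" "y \<noteq> 1" for i j m y
      using that k(1) by auto
    have t2: "cj t $ 1 $ 2 = 0" "cj t $ 1 $ 3 = 0" "cj t $ 2 $ 2 = 0" "cj t $ 3 $ 3 = 0"
    proof -
      show "cj t $ 1 $ 2 = 0" using e[of 1 2] root
        by (intro z[of "\<kappa> * (\<kappa> * \<omega>\<^sup>2)" _ _ "\<omega>\<^sup>2"]) (simp_all add: s5' c mult_ac)
      show "cj t $ 1 $ 3 = 0" using e[of 1 3] \<omega>(2)
        by (intro z[of "\<kappa> * (\<kappa> * \<omega>)" _ _ "\<omega>"]) (simp_all add: s5' c mult_ac)
      have "(\<kappa> * \<omega>\<^sup>2) * (\<kappa> * \<omega>\<^sup>2) = \<kappa> * \<kappa> * (\<omega>\<^sup>2 * \<omega>\<^sup>2)" by (simp only: mult_ac)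
      note m2 = this[unfolded w4]
      show "cj t $ 2 $ 2 = 0" using e[of 2 2]
        by (intro z[OF _ m2 \<omega>(2)]) (simp add: s5' c mult_ac)
      show "cj t $ 3 $ 3 = 0" using e[of 3 3] root
        by (intro z[of "(\<kappa> * \<omega>) * (\<kappa> * \<omega>)" _ _ "\<omega>\<^sup>2"]) (simp_all add: s5' c mult_ac power2_eq_square)
    qed
    have "C *v (C' *v u) = u" by (simp add: matrix_vector_mul_assoc C(1))
    then have "cj t *v vec 1 = \<beta> *s vec 1"
      by (simp only: cj_vec C'u b vector_scalar_commute)
    then have "(cj t *v vec 1) $ i = \<beta>" for i by simp
    note f = this[unfolded matrix_vector_mult_def vec_lambda_beta sum_3]
    have t3: "\<alpha> = \<beta>" "cj t $ 2 $ 3 = \<beta>" "cj t $ 3 $ 2 = \<beta>"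
      using f[of 1] f[of 2] f[of 3] by (simp_all add: t1 t2)
    show "transpose (cj t) = cj t"
      by (simp add: transpose_def vec_eq_iff forall_3 t1 t2 t3)
    show "cj t ** cj t = mat (\<beta>\<^sup>2)"
      by (simp add: matrix_matrix_mult_def vec_eq_iff forall_3 sum_3 t1 t2 t3 mat_def power2_eq_square)
  qed
  have s1'': "cj s1 ** transpose (cj s1) = mat (\<mu>\<^sup>2)"
    by (simp add: matrix_matrix_mult_def transpose_def vec_eq_iff forall_3 sum_3 s1' mat_def power2_eq_square)
  have s5'': "transpose (cj s5) = cj s5"
    by (simp add: transpose_def vec_eq_iff forall_3 s5')
  have sq: "cj D ** cj D = mat d" "cj D4 ** cj D4 = mat d4"
    by (simp_all only: cj_mult[symmetric] D(1) D4(1) cj_mat)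
  \<comment> \<open>In the new basis the four matrices other than \<open>s5\<close> times their
    transposes are scalar, while \<open>s5\<close> is symmetric. Congruence by \<open>C\<close>
    carries these two properties to relations with \<open>M\<close>.\<close>
  define M where "M = C ** transpose C"
  have XM: "X ** M = C ** cj X ** transpose C" for X
    by (simp only: M_def matrix_mul_assoc XC)
  have MX: "M ** transpose X = C ** transpose (cj X) ** transpose C" for X
    by (simp only: M_def matrix_mul_assoc[symmetric] matrix_transpose_mul[symmetric] XC)
  have form: "X ** M ** transpose X = mat x ** M" if "cj X ** transpose (cj X) = mat x" for X x
  proof -
    have "X ** M ** transpose X = X ** (C ** transpose (cj X) ** transpose C)"
      by (simp only: matrix_mul_assoc[symmetric] MX)
    also have "\<dots> = C ** (cj X ** transpose (cj X)) ** transpose C"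
      by (simp only: matrix_mul_assoc XC)
    also have "\<dots> = mat x ** M" by (simp only: that M_def mat_commute[of x C, symmetric] matrix_mul_assoc)
    finally show ?thesis .
  qed
  show ?thesis
  proof
    have "det C * det C' = 1" using arg_cong[OF C(1), of det] by (simp add: det_mul)
    then have "det C \<noteq> 0" by auto
    then show "det M \<noteq> 0" by (simp add: M_def det_mul det_transpose)
    show "s5 ** M = M ** transpose s5" by (simp only: XM MX s5'')
    show "\<exists>x. X ** M ** transpose X = mat x ** M" if "X \<in> {s1, D, D4, t}" for X
      using that form[OF s1''] form[of D, unfolded D', OF sq(1)] form[of D4, unfolded D4', OF sq(2)]
        form[of t, unfolded t'(1), OF t'(2)] by blast
  qed
qed

section \<open>Groups with the string property\<close>

lemma (in group) invol_product_inverts: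
  assumes x: "x \<in> carrier G" and y: "y \<in> carrier G" and s: "s = x \<otimes> y"
    and xx: "x \<otimes> x = \<one>" and yy: "y \<otimes> y = \<one>"
  shows "x \<otimes> s \<otimes> x = inv s" "y \<otimes> s \<otimes> y = inv s"
proof -
  have ix: "inv x = x" and iy: "inv y = y" using inv_equality[OF xx x x] inv_equality[OF yy y y] by auto
  have i: "inv s = y \<otimes> x" using x y by (simp add: s inv_mult_group ix iy)
  have "x \<otimes> s = y" using x y by (simp add: s m_assoc[symmetric] xx)
  then show "x \<otimes> s \<otimes> x = inv s" by (simp add: i)
  show "y \<otimes> s \<otimes> y = inv s" unfolding i using x y by (simp add: s m_assoc yy)
qed

lemma foldr_mult_append:
  assumes "monoid G" "set xs \<subseteq> carrier G" "set ys \<subseteq> carrier G"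
  shows "foldr (\<lambda>x y. x \<otimes>\<^bsub>G\<^esub> y) (xs @ ys) \<one>\<^bsub>G\<^esub> =
    foldr (\<lambda>x y. x \<otimes>\<^bsub>G\<^esub> y) xs \<one>\<^bsub>G\<^esub> \<otimes>\<^bsub>G\<^esub> foldr (\<lambda>x y. x \<otimes>\<^bsub>G\<^esub> y) ys \<one>\<^bsub>G\<^esub>"
    "foldr (\<lambda>x y. x \<otimes>\<^bsub>G\<^esub> y) xs \<one>\<^bsub>G\<^esub> \<in> carrier G"
proof -
  interpret monoid G by fact
  have c: "foldr (\<lambda>x y. x \<otimes>\<^bsub>G\<^esub> y) zs \<one>\<^bsub>G\<^esub> \<in> carrier G" if "set zs \<subseteq> carrier G" for zs
    using that by (induction zs) auto
  then show "foldr (\<lambda>x y. x \<otimes>\<^bsub>G\<^esub> y) xs \<one>\<^bsub>G\<^esub> \<in> carrier G" using assms by blast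
  show "foldr (\<lambda>x y. x \<otimes>\<^bsub>G\<^esub> y) (xs @ ys) \<one>\<^bsub>G\<^esub> =
    foldr (\<lambda>x y. x \<otimes>\<^bsub>G\<^esub> y) xs \<one>\<^bsub>G\<^esub> \<otimes>\<^bsub>G\<^esub> foldr (\<lambda>x y. x \<otimes>\<^bsub>G\<^esub> y) ys \<one>\<^bsub>G\<^esub>"
    using assms(2,3) c by (induction xs) (auto simp: m_assoc)
qed

lemma (in group) commute_mult:
  assumes "x \<in> carrier G" "y \<in> carrier G" "z \<in> carrier G" "x \<otimes> z = z \<otimes> x" "y \<otimes> z = z \<otimes> y"
  shows "(x \<otimes> y) \<otimes> z = z \<otimes> (x \<otimes> y)"
  using assms by (metis m_assoc)

locale string_group = group G for G (structure) +
  fixes r :: nat and \<sigma> :: "nat \<Rightarrow> 'a"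
  assumes \<sigma>_closed': "\<sigma> ` {1..r - 1} \<subseteq> carrier G"
    and string: "string_property G r \<sigma>"
begin

abbreviation \<tau> where "\<tau> \<equiv> tau G \<sigma>"

lemma \<sigma>_closed: "1 \<le> i \<Longrightarrow> i \<le> r - 1 \<Longrightarrow> \<sigma> i \<in> carrier G"
  using \<sigma>_closed' by auto

lemma \<tau>_closed: "1 \<le> i \<Longrightarrow> j \<le> r - 1 \<Longrightarrow> \<tau> i j \<in> carrier G"
  unfolding tau_def by (rule foldr_mult_append(2)[where ys="[]"]) (auto intro!: \<sigma>_closed)

lemma \<tau>_same: "1 \<le> i \<Longrightarrow> i \<le> r - 1 \<Longrightarrow> \<tau> i i = \<sigma> i"
  by (simp add: tau_def \<sigma>_closed)

lemma \<tau>_append: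
  assumes "1 \<le> i" "i \<le> Suc j" "j \<le> k" "k \<le> r - 1"
  shows "\<tau> i k = \<tau> i j \<otimes> \<tau> (Suc j) k"
proof -
  have "[i..<Suc k] = [i..<Suc j] @ [Suc j..<Suc k]"
    using upt_add_eq_append[of i "Suc j" "k - j"] assms by simp
  then show ?thesis unfolding tau_def
    using assms by (simp only: map_append) (rule foldr_mult_append(1), auto intro!: \<sigma>_closed)
qed

lemma \<tau>_Cons: "1 \<le> i \<Longrightarrow> i < k \<Longrightarrow> k \<le> r - 1 \<Longrightarrow> \<tau> i k = \<sigma> i \<otimes> \<tau> (Suc i) k"
  using \<tau>_append[of i i k] \<tau>_same[of i] by simp

lemma \<tau>_snoc: "1 \<le> i \<Longrightarrow> i < k \<Longrightarrow> k \<le> r - 1 \<Longrightarrow> \<tau> i k = \<tau> i (k - 1) \<otimes> \<sigma> k"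
  using \<tau>_append[of i "k - 1" k] \<tau>_same[of k] by simp

lemma \<tau>_ord: "1 \<le> i \<Longrightarrow> i < j \<Longrightarrow> j \<le> r - 1 \<Longrightarrow> ord (\<tau> i j) = 2"
  using string unfolding string_property_def by blast

lemma \<tau>_neq_one: "1 \<le> i \<Longrightarrow> i < j \<Longrightarrow> j \<le> r - 1 \<Longrightarrow> \<tau> i j \<noteq> \<one>"
  using \<tau>_ord[of i j] by auto

lemma \<tau>_square: "1 \<le> i \<Longrightarrow> i < j \<Longrightarrow> j \<le> r - 1 \<Longrightarrow> \<tau> i j \<otimes> \<tau> i j = \<one>"
  using \<tau>_ord[of i j] pow_ord_eq_1[OF \<tau>_closed[of i j]] \<tau>_closed[of i j]
  by (simp add: numeral_2_eq_2)

text \<open>For \<open>Suc i < k\<close> both \<open>\<tau> i (k - 1)\<close> and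
  \<open>\<tau> i k\<close> are involutions. Their product is \<open>\<sigma> k\<close>, so each
  inverts it, as in a dihedral group.\<close>

lemma \<tau>_inverts_last:
  assumes "1 \<le> i" "Suc i < k" "k \<le> r - 1"
  shows "\<tau> i k \<otimes> \<sigma> k \<otimes> \<tau> i k = inv (\<sigma> k)"
proof -
  have "\<tau> i (k - 1) \<otimes> \<tau> i k = (\<tau> i (k - 1) \<otimes> \<tau> i (k - 1)) \<otimes> \<sigma> k"
    using assms by (simp add: \<tau>_snoc[of i k] m_assoc \<tau>_closed \<sigma>_closed)
  also have "\<dots> = \<sigma> k" using assms by (simp add: \<tau>_square \<sigma>_closed)
  finally show ?thesis
    using assms invol_product_inverts(2)[of "\<tau> i (k - 1)" "\<tau> i k" "\<sigma> k"]
    by (simp add: \<tau>_closed \<tau>_square)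
qed

lemma \<tau>_inverts_first:
  assumes "1 \<le> i" "Suc i < k" "k \<le> r - 1"
  shows "\<tau> i k \<otimes> \<sigma> i \<otimes> \<tau> i k = inv (\<sigma> i)"
proof -
  have "\<tau> i k \<otimes> \<tau> (Suc i) k = \<sigma> i \<otimes> (\<tau> (Suc i) k \<otimes> \<tau> (Suc i) k)"
    using assms by (simp add: \<tau>_Cons[of i k] m_assoc \<tau>_closed \<sigma>_closed)
  also have "\<dots> = \<sigma> i" using assms by (simp add: \<tau>_square \<sigma>_closed)
  finally show ?thesis
    using assms invol_product_inverts(1)[of "\<tau> i k" "\<tau> (Suc i) k" "\<sigma> i"]
    by (simp add: \<tau>_closed \<tau>_square)
qed

text \<open>\<open>\<sigma> a\<close> is the product of \<open>\<tau> a b\<close> and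
  \<open>\<tau> (Suc a) b\<close>. The gap of three makes both of them invert
  \<open>\<sigma> b\<close>, so their product centralizes it.\<close>

lemma \<sigma>_commute:
  assumes "1 \<le> a" "a + 3 \<le> b" "b \<le> r - 1"
  shows "\<sigma> a \<otimes> \<sigma> b = \<sigma> b \<otimes> \<sigma> a"
proof -
  let ?x = "\<tau> a b" and ?y = "\<tau> (Suc a) b"
  have c: "?x \<in> carrier G" "?y \<in> carrier G" "\<sigma> a \<in> carrier G" "\<sigma> b \<in> carrier G"
    using assms by (auto intro: \<tau>_closed \<sigma>_closed)
  have sq: "?x \<otimes> ?x = \<one>" "?y \<otimes> ?y = \<one>" using assms by (auto intro!: \<tau>_square)
  have x: "?x \<otimes> \<sigma> b \<otimes> ?x = inv (\<sigma> b)" and y: "?y \<otimes> \<sigma> b \<otimes> ?y = inv (\<sigma> b)"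
    using assms by (auto intro!: \<tau>_inverts_last)
  have "?x \<otimes> ?y = \<sigma> a \<otimes> (?y \<otimes> ?y)" using assms c by (simp add: \<tau>_Cons[of a b] m_assoc)
  then have a: "\<sigma> a = ?x \<otimes> ?y" using c sq by simp
  have "?x \<otimes> \<sigma> b \<otimes> ?x = ?y \<otimes> \<sigma> b \<otimes> ?y" using x y by simp
  then have "?x \<otimes> (?x \<otimes> \<sigma> b \<otimes> ?x) \<otimes> ?y = ?x \<otimes> (?y \<otimes> \<sigma> b \<otimes> ?y) \<otimes> ?y" by simp
  moreover have "?x \<otimes> (?x \<otimes> \<sigma> b \<otimes> ?x) \<otimes> ?y = (?x \<otimes> ?x) \<otimes> \<sigma> b \<otimes> (?x \<otimes> ?y)"
    using c by (simp add: m_assoc)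
  moreover have "?x \<otimes> (?y \<otimes> \<sigma> b \<otimes> ?y) \<otimes> ?y = (?x \<otimes> ?y) \<otimes> \<sigma> b \<otimes> (?y \<otimes> ?y)"
    using c by (simp add: m_assoc)
  ultimately show ?thesis using c sq by (simp add: a[symmetric])
qed

lemma mult_commute_imp:
  assumes "x \<in> carrier G" "y \<in> carrier G" "x \<otimes> x = \<one>" "y \<otimes> y = \<one>" "(x \<otimes> y) \<otimes> (x \<otimes> y) = \<one>"
  shows "x \<otimes> y = y \<otimes> x"
proof -
  have "inv (x \<otimes> y) = x \<otimes> y" using assms by (intro inv_equality) auto
  moreover have "inv x = x" "inv y = y" using assms by (auto intro: inv_equality)
  ultimately show ?thesis using assms inv_mult_group[of x y] by simp
qed

text \<open>If the two commute, the square of their product being trivial makes the square of the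
  first the inverse of the square of the second. It then lies in both cyclic subgroups, which meet
  trivially by the intersection property.\<close>

lemma adjacent_commute_imp_involution:
  assumes ip: "intersection_property G r \<sigma>" and a: "1 \<le> a" "Suc a \<le> r - 1"
    and comm: "\<sigma> a \<otimes> \<sigma> (Suc a) = \<sigma> (Suc a) \<otimes> \<sigma> a"
  shows "\<sigma> a \<otimes> \<sigma> a = \<one>" "\<sigma> (Suc a) \<otimes> \<sigma> (Suc a) = \<one>"
proof -
  define x where "x = \<sigma> a"
  define y where "y = \<sigma> (Suc a)"
  have c: "x \<in> carrier G" "y \<in> carrier G" using a by (auto simp: x_def y_def intro: \<sigma>_closed)
  \<comment> \<open>Keeping only the indices \<open>a - 1\<close> and \<open>a\<close> leaves the
    single generator \<open>\<sigma> a\<close>; \<open>J\<close> likewise leaves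
    \<open>\<sigma> (Suc a)\<close>, and the union keeps only one index, hence no generator.\<close>
  define I where "I = {0..r - 1} - {a - 1, a}"
  define J where "J = {0..r - 1} - {a, Suc a}"
  have IJ: "tau_subgroup G r \<sigma> I \<inter> tau_subgroup G r \<sigma> J = tau_subgroup G r \<sigma> (I \<union> J)"
    using ip[unfolded intersection_property_def, rule_format, of I J] by (auto simp: I_def J_def)
  have "I \<union> J = {0..r - 1} - {a}" using a by (auto simp: I_def J_def)
  then have "\<not> (1 \<le> i \<and> i \<le> j \<and> j \<le> r - 1 \<and> i - 1 \<notin> I \<union> J \<and> j \<notin> I \<union> J)" for i j
    by (cases i) auto
  then have "{\<tau> i j | i j. 1 \<le> i \<and> i \<le> j \<and> j \<le> r - 1 \<and> i - 1 \<notin> I \<union> J \<and> j \<notin> I \<union> J} = {}"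
    by blast
  note empty = this
  have triv: "tau_subgroup G r \<sigma> (I \<union> J) = {\<one>}"
    unfolding tau_subgroup_def empty by (rule generate_empty)
  have sub: "{\<tau> i j | i j. 1 \<le> i \<and> i \<le> j \<and> j \<le> r - 1 \<and> i - 1 \<notin> L \<and> j \<notin> L} \<subseteq> carrier G" for L
    by (auto intro: \<tau>_closed)
  have grp: "subgroup (tau_subgroup G r \<sigma> L) G" for L
    unfolding tau_subgroup_def by (rule generate_is_subgroup[OF sub])
  have inI: "x \<in> tau_subgroup G r \<sigma> I" unfolding tau_subgroup_def x_def
    using a \<tau>_same[of a] by (intro generate.incl CollectI exI[of _ a]) (auto simp: I_def)
  have inJ: "y \<in> tau_subgroup G r \<sigma> J" unfolding tau_subgroup_def y_def
    using a \<tau>_same[of "Suc a"] by (intro generate.incl CollectI exI[of _ "Suc a"]) (auto simp: J_def)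
  have "\<tau> a (Suc a) = x \<otimes> y" using a \<tau>_Cons[of a "Suc a"] \<tau>_same[of "Suc a"] by (simp add: x_def y_def)
  then have "(x \<otimes> y) \<otimes> (x \<otimes> y) = \<one>" using \<tau>_square[of a "Suc a"] a by simp
  moreover have "(x \<otimes> y) \<otimes> (x \<otimes> y) = x \<otimes> (y \<otimes> x) \<otimes> y" using c by (simp add: m_assoc)
  moreover have yx: "y \<otimes> x = x \<otimes> y" using comm by (simp add: x_def y_def)
  moreover have "x \<otimes> (y \<otimes> x) \<otimes> y = (x \<otimes> x) \<otimes> (y \<otimes> y)"
    unfolding yx using c by (simp add: m_assoc)
  ultimately have xy: "(x \<otimes> x) \<otimes> (y \<otimes> y) = \<one>" by simp
  then have "x \<otimes> x = inv (y \<otimes> y)" using c by (intro inv_equality[symmetric]) auto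
  then have "x \<otimes> x \<in> tau_subgroup G r \<sigma> J"
    using inJ grp[of J] by (simp add: subgroup.m_closed subgroup.m_inv_closed)
  moreover have "x \<otimes> x \<in> tau_subgroup G r \<sigma> I" using inI grp[of I] by (simp add: subgroup.m_closed)
  ultimately have 1: "x \<otimes> x = \<one>" using IJ triv by blast
  then show "\<sigma> a \<otimes> \<sigma> a = \<one>" by (simp add: x_def)
  show "\<sigma> (Suc a) \<otimes> \<sigma> (Suc a) = \<one>" using xy 1 c by (simp add: y_def)
qed

text \<open>The identity is then the automorphism that chirality forbids.\<close>

lemma first_involution_not_chiral:
  assumes "r \<ge> 3" and "\<sigma> 1 \<otimes> \<sigma> 1 = \<one>"
  shows "\<not> chirality G r \<sigma>"
proof -
  have "\<sigma> 1 \<in> carrier G" using assms by (intro \<sigma>_closed) auto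
  then have "inv (\<sigma> 1) = \<sigma> 1" using assms by (intro inv_equality) auto
  moreover have "(\<lambda>x. x) \<in> iso G G" by (auto simp: iso_def hom_def bij_betw_def)
  ultimately show ?thesis unfolding chirality_def by force
qed

lemma conj_iso:
  assumes g: "g \<in> carrier G" and gg: "g \<otimes> g = \<one>"
  shows "(\<lambda>x. g \<otimes> x \<otimes> g) \<in> iso G G"
proof -
  have gg': "g \<otimes> (g \<otimes> x) = x" if "x \<in> carrier G" for x
    using that g gg by (simp add: m_assoc[symmetric])
  have "g \<otimes> (g \<otimes> x \<otimes> g) \<otimes> g = x" if "x \<in> carrier G" for x
    using that g gg gg' by (simp add: m_assoc)
  then have "bij_betw (\<lambda>x. g \<otimes> x \<otimes> g) (carrier G) (carrier G)"
    using g by (intro bij_betw_byWitness[where f'="\<lambda>x. g \<otimes> x \<otimes> g"]) auto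
  moreover have "g \<otimes> (x \<otimes> y) \<otimes> g = (g \<otimes> x \<otimes> g) \<otimes> (g \<otimes> y \<otimes> g)"
    if "x \<in> carrier G" "y \<in> carrier G" for x y
    using that g gg' by (simp add: m_assoc)
  ultimately show ?thesis using g by (auto simp: iso_def hom_def)
qed

text \<open>\<open>\<tau> 1 n\<close> is \<open>\<tau> 1 i\<close> times
  \<open>\<tau> (Suc i) n\<close>, and two involutions with involutory product commute. The square
  of the second factor is a hypothesis because for \<open>Suc i = n\<close> this factor is
  \<open>\<sigma> n\<close>.\<close>

lemma conj_\<tau>_prefix:
  assumes i: "2 \<le> i" "i < n" "n \<le> r - 1" and uu: "\<tau> (Suc i) n \<otimes> \<tau> (Suc i) n = \<one>"
  shows "\<tau> 1 n \<otimes> \<tau> 1 i \<otimes> \<tau> 1 n = \<tau> 1 i"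
proof -
  have t: "\<tau> 1 i \<in> carrier G" "\<tau> 1 i \<otimes> \<tau> 1 i = \<one>"
    and g: "\<tau> 1 n \<in> carrier G" "\<tau> 1 n \<otimes> \<tau> 1 n = \<one>"
    and u: "\<tau> (Suc i) n \<in> carrier G"
    using i by (auto intro!: \<tau>_closed \<tau>_square)
  have g': "\<tau> 1 n = \<tau> 1 i \<otimes> \<tau> (Suc i) n" using i by (intro \<tau>_append) auto
  have c: "\<tau> 1 i \<otimes> \<tau> (Suc i) n = \<tau> (Suc i) n \<otimes> \<tau> 1 i"
    using t u uu g unfolding g' by (intro mult_commute_imp) auto
  have "\<tau> 1 n \<otimes> \<tau> 1 i = \<tau> 1 i \<otimes> \<tau> 1 n"
    unfolding g' using t u by (simp only: c[symmetric] m_assoc)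
  then show ?thesis using g t by (simp add: m_assoc)
qed

text \<open>Conjugation by \<open>\<tau> 1 n\<close> always inverts \<open>\<sigma> 1\<close>; once
  \<open>\<sigma> n\<close> is an involution it also fixes every \<open>\<tau> 1 i\<close>,
  including \<open>i = n - 1\<close>, against chirality.\<close>

lemma last_involution_not_chiral:
  assumes r: "r \<ge> 4" and ss: "\<sigma> (r - 1) \<otimes> \<sigma> (r - 1) = \<one>"
  shows "\<not> chirality G r \<sigma>"
proof -
  define n where "n = r - 1"
  have n: "n \<ge> 3" "n \<le> r - 1" using r by (auto simp: n_def)
  define g where "g = \<tau> 1 n"
  have g: "g \<in> carrier G" "g \<otimes> g = \<one>" using n by (auto simp: g_def intro: \<tau>_closed \<tau>_square)
  have 1: "g \<otimes> \<sigma> 1 \<otimes> g = inv (\<sigma> 1)" unfolding g_def using n by (intro \<tau>_inverts_first) auto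
  have sn: "\<sigma> n \<otimes> \<sigma> n = \<one>" using ss by (simp only: n_def)
  have 2: "g \<otimes> \<tau> 1 i \<otimes> g = \<tau> 1 i" if i: "2 \<le> i" "i \<le> n" for i
  proof (cases "i = n")
    case True
    then have "\<tau> 1 i = g" by (simp add: g_def)
    then show ?thesis using g by simp
  next
    case False
    have "\<tau> (Suc i) n \<otimes> \<tau> (Suc i) n = \<one>"
    proof (cases "Suc i = n")
      case True
      then show ?thesis using n i sn by (simp add: \<tau>_same)
    qed (use i False n in \<open>auto intro!: \<tau>_square\<close>)
    then show ?thesis unfolding g_def using i n False by (intro conj_\<tau>_prefix) auto
  qed
  show ?thesis unfolding chirality_def using conj_iso[OF g] 1 2 n_def by auto
qed

end

section \<open>Matrix groups modulo scalars\<close>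

text \<open>Treats SL(3,q) and SU(3,q) together; \<open>Q\<close> below becomes PSL(3,q) or
  PSU(3,q).\<close>

locale special_linear_group = group K for K :: "('a::{field,finite} ^ 3 ^ 3) monoid" (structure) +
  assumes mult_K: "mult K = (**)" and one_K: "one K = mat 1"
    and det_K: "A \<in> carrier K \<Longrightarrow> det A = 1"
begin

definition Q where "Q = K Mod scalars K"

definition proj where "proj A = scalars K #> A"

lemma normal_Z: "scalars K \<lhd> K" by (rule normal_scalars[OF is_group mult_K one_K])

sublocale Z: normal "scalars K" K by (rule normal_Z)

sublocale Q: group Q unfolding Q_def by (rule Z.factorgroup_is_group)

lemma mult_closed: "A \<in> carrier K \<Longrightarrow> B \<in> carrier K \<Longrightarrow> A ** B \<in> carrier K"
  using m_closed[of A B] by (simp add: mult_K)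

lemma inv_left: "A \<in> carrier K \<Longrightarrow> inv A ** A = mat 1"
  using l_inv[of A] by (simp add: mult_K one_K)

lemma inv_right: "A \<in> carrier K \<Longrightarrow> A ** inv A = mat 1"
  using r_inv[of A] by (simp add: mult_K one_K)

lemma mat_1_closed: "mat 1 \<in> carrier K" using one_closed by (simp add: one_K)

lemma det_nz: "A \<in> carrier K \<Longrightarrow> det A \<noteq> 0" using det_K by simp

lemma scalarsI: "mat c \<in> carrier K \<Longrightarrow> mat c \<in> scalars K" unfolding scalars_def by blast

lemma carrier_Q: "carrier Q = proj ` carrier K"
  by (simp add: Q_def carrier_FactGroup proj_def)

lemma proj_closed: "A \<in> carrier K \<Longrightarrow> proj A \<in> carrier Q"
  by (simp add: carrier_Q)

lemma proj_mult: "A \<in> carrier K \<Longrightarrow> B \<in> carrier K \<Longrightarrow> proj (A ** B) = proj A \<otimes>\<^bsub>Q\<^esub> proj B"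
  using Z.rcos_sum[of A B] by (simp add: Q_def proj_def mult_K)

lemma proj_one: "proj (mat 1) = \<one>\<^bsub>Q\<^esub>"
  using coset_mult_one[OF Z.subset] by (simp add: Q_def proj_def one_K)

lemma proj_inv: "A \<in> carrier K \<Longrightarrow> proj (inv A) = inv\<^bsub>Q\<^esub> (proj A)"
  using proj_mult[of "inv A" A] by (intro Q.inv_equality[symmetric]) (simp_all add: inv_left proj_one proj_closed)

lemma proj_eq_iff:
  assumes A: "A \<in> carrier K" and B: "B \<in> carrier K"
  shows "proj A = proj B \<longleftrightarrow> (\<exists>c. A = mat c ** B)"
proof
  assume "proj A = proj B"
  then have "A \<in> scalars K #> B"
    using rcos_self[OF A Z.subgroup_axioms] by (simp add: proj_def)
  then obtain z where "z \<in> scalars K" "A = z ** B" by (auto simp: r_coset_def mult_K)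
  then show "\<exists>c. A = mat c ** B" unfolding scalars_def by blast
next
  assume "\<exists>c. A = mat c ** B"
  then obtain c where c: "A = mat c ** B" by blast
  have "A ** inv B = mat c" by (simp add: c matrix_mul_assoc[symmetric] inv_right[OF B])
  then have "mat c \<in> scalars K" using mult_closed[OF A inv_closed[OF B]] by (intro scalarsI) simp
  then have "A \<in> scalars K #> B" by (auto simp: r_coset_def c mult_K)
  then show "proj A = proj B" unfolding proj_def
    using repr_independence[OF _ B Z.subgroup_axioms] by simp
qed

lemma scalar_cube:
  assumes "A \<in> carrier K" "B \<in> carrier K" "A = mat c ** B"
  shows "c ^ 3 = 1"
  using arg_cong[OF assms(3), of det] assms(1,2) by (simp add: det_mul det_mat det_K)

lemma proj_commute:
  assumes A: "A \<in> carrier K" and B: "B \<in> carrier K"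
    and comm: "proj A \<otimes>\<^bsub>Q\<^esub> proj B = proj B \<otimes>\<^bsub>Q\<^esub> proj A"
  obtains c where "A ** B = mat c ** (B ** A)" "c ^ 3 = 1"
proof -
  have "proj (A ** B) = proj (B ** A)" using comm by (simp add: proj_mult A B)
  then obtain c where c: "A ** B = mat c ** (B ** A)"
    using proj_eq_iff[OF mult_closed[OF A B] mult_closed[OF B A]] by blast
  then show ?thesis using that scalar_cube[OF mult_closed[OF A B] mult_closed[OF B A] c] by blast
qed

lemma proj_one_scalar: "A \<in> carrier K \<Longrightarrow> proj A = \<one>\<^bsub>Q\<^esub> \<longleftrightarrow> (\<exists>c. A = mat c)"
  using proj_eq_iff[OF _ mat_1_closed, of A] by (simp add: proj_one)

text \<open>The scalar ambiguity of order three is invisible to involutions.\<close>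

lemma involution_commute:
  assumes A: "A \<in> carrier K" and B: "B \<in> carrier K"
    and sq: "proj A \<otimes>\<^bsub>Q\<^esub> proj A = \<one>\<^bsub>Q\<^esub>"
    and comm: "proj A \<otimes>\<^bsub>Q\<^esub> proj B = proj B \<otimes>\<^bsub>Q\<^esub> proj A"
  shows "A ** B = B ** A"
proof -
  obtain c where c: "A ** B = mat c ** (B ** A)" "c ^ 3 = 1" using proj_commute[OF A B comm] .
  obtain d where d: "A ** A = mat d"
    using sq proj_one_scalar[OF mult_closed[OF A A]] by (auto simp: proj_mult A)
  have "d \<noteq> 0" using scalar_cube[OF mult_closed[OF A A] mat_1_closed, of d] by (auto simp: d)
  \<comment> \<open>Moving both factors \<open>A\<close> past \<open>B\<close> produces
    \<open>c * c\<close>, while \<open>A ** A\<close> is scalar and commutes with \<open>B\<close>.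
    So \<open>c * c = 1\<close>, which with \<open>c ^ 3 = 1\<close> gives
    \<open>c = 1\<close>.\<close>
  have "A ** A ** B = A ** (mat c ** (B ** A))" by (simp only: matrix_mul_assoc[symmetric] c)
  also have "\<dots> = mat c ** (A ** B) ** A"
    by (simp only: matrix_mul_assoc mat_commute[of c A])
  also have "\<dots> = mat (c * c) ** B ** (A ** A)"
    by (simp only: c(1) matrix_mul_assoc mat_mult_mat)
  finally have "mat d ** B = mat (c * c) ** B ** mat d" by (simp only: d)
  also have "\<dots> = mat (d * (c * c)) ** B"
    by (simp only: mat_commute[of d, symmetric] matrix_mul_assoc mat_mult_mat)
  finally have "d = d * (c * c)" using scalar_mult_cancel[OF det_nz[OF B]] by blast
  then have "c * c = 1" using \<open>d \<noteq> 0\<close> by simp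
  then have "c = 1" using c(2) by (simp add: power3_eq_cube)
  then show ?thesis using c by simp
qed

text \<open>\<open>H\<close> contains the kernel of \<open>proj\<close>, and its image is a subgroup
  containing generators of \<open>Q\<close>.\<close>

lemma subgroup_eq_carrier:
  assumes H: "subgroup H K" and Z: "scalars K \<subseteq> H"
    and gen: "generate Q S = carrier Q" and S: "S \<subseteq> proj ` H"
  shows "H = carrier K"
proof
  show "H \<subseteq> carrier K" using H by (rule subgroup.subset)
  interpret H: subgroup H K by fact
  have "subgroup (proj ` H) Q"
  proof (rule Q.subgroupI)
    show "proj ` H \<subseteq> carrier Q" using H.subset proj_closed by blast
    show "proj ` H \<noteq> {}" using H.one_closed by blast
    fix X assume "X \<in> proj ` H"
    then obtain A where A: "A \<in> H" "X = proj A" by blast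
    then show "inv\<^bsub>Q\<^esub> X \<in> proj ` H" using proj_inv[of A] H.subset H.m_inv_closed[of A] by auto
    fix Y assume "Y \<in> proj ` H"
    then obtain B where B: "B \<in> H" "Y = proj B" by blast
    show "X \<otimes>\<^bsub>Q\<^esub> Y \<in> proj ` H"
      using A B proj_mult[of A B] H.m_closed[of A B] H.subset by (auto simp: mult_K)
  qed
  then have *: "carrier Q \<subseteq> proj ` H" using Q.generate_subgroup_incl[OF S] gen by simp
  show "carrier K \<subseteq> H"
  proof
    fix A assume A: "A \<in> carrier K"
    then obtain B where B: "B \<in> H" "proj A = proj B" using * proj_closed[OF A] by blast
    then have "A \<in> scalars K #> B"
      using rcos_self[OF A Z.subgroup_axioms] by (simp add: proj_def)
    then show "A \<in> H" using Z B H.m_closed by (auto simp: r_coset_def)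
  qed
qed

text \<open>Sending scalars to scalars makes the map on the quotient well defined. Finiteness
  replaces a kernel computation: the injective \<open>\<Psi>\<close> is onto, hence so is the
  induced map of the finite quotient, which is then injective.\<close>

lemma induced_iso:
  assumes hom: "\<And>A B. A \<in> carrier K \<Longrightarrow> B \<in> carrier K \<Longrightarrow> \<Psi> (A ** B) = \<Psi> A ** \<Psi> B"
    and closed: "\<And>A. A \<in> carrier K \<Longrightarrow> \<Psi> A \<in> carrier K"
    and inj: "inj_on \<Psi> (carrier K)"
    and scal: "\<And>c. mat c \<in> carrier K \<Longrightarrow> \<exists>d. \<Psi> (mat c) = mat d"
  shows "\<exists>\<phi> \<in> iso Q Q. \<forall>A \<in> carrier K. \<phi> (proj A) = proj (\<Psi> A)"
proof -
  define \<phi> where "\<phi> X = proj (\<Psi> (SOME A. A \<in> carrier K \<and> X = proj A))" for X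
  have \<phi>: "\<phi> (proj A) = proj (\<Psi> A)" if A: "A \<in> carrier K" for A
  proof -
    define B where "B = (SOME B. B \<in> carrier K \<and> proj A = proj B)"
    have "B \<in> carrier K \<and> proj A = proj B" unfolding B_def by (rule someI[of _ A]) (simp add: A)
    then have B: "B \<in> carrier K" "proj B = proj A" by auto
    then obtain c where c: "B = mat c ** A" using proj_eq_iff[OF B(1) A] by blast
    then have "B ** inv A = mat c" by (simp add: matrix_mul_assoc[symmetric] inv_right[OF A])
    then have cK: "mat c \<in> carrier K" using mult_closed[OF B(1) inv_closed[OF A]] by simp
    then obtain d where "\<Psi> (mat c) = mat d" using scal by blast
    then have "\<Psi> B = mat d ** \<Psi> A" by (simp add: c hom cK A)
    then have "proj (\<Psi> B) = proj (\<Psi> A)" using proj_eq_iff[OF closed[OF B(1)] closed[OF A]] by blast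
    then show ?thesis by (simp add: \<phi>_def B_def)
  qed
  have "\<Psi> ` carrier K = carrier K"
    using inj closed by (intro endo_inj_surj) auto
  then have "\<phi> ` carrier Q = carrier Q"
    by (simp add: carrier_Q image_image \<phi> cong: image_cong) (metis image_image)
  moreover have "finite (carrier Q)" by (simp add: carrier_Q)
  ultimately have "bij_betw \<phi> (carrier Q) (carrier Q)"
    by (simp add: bij_betw_def eq_card_imp_inj_on)
  moreover have "\<phi> \<in> hom Q Q"
  proof (rule homI)
    fix X assume "X \<in> carrier Q"
    then obtain A where A: "A \<in> carrier K" "X = proj A" by (auto simp: carrier_Q)
    then show "\<phi> X \<in> carrier Q" by (simp add: \<phi> proj_closed closed)
    fix Y assume "Y \<in> carrier Q"
    then obtain B where B: "B \<in> carrier K" "Y = proj B" by (auto simp: carrier_Q)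
    show "\<phi> (X \<otimes>\<^bsub>Q\<^esub> Y) = \<phi> X \<otimes>\<^bsub>Q\<^esub> \<phi> Y"
      unfolding A B using A B
      by (simp add: proj_mult[symmetric] \<phi> mult_closed hom closed)
  qed
  ultimately show ?thesis using \<phi> by (auto simp: iso_def)
qed

end

section \<open>Matrix lifts of a chiral tuple\<close>

text \<open>The situation to be refuted. The lifts \<open>s i\<close> are arbitrary, so relations of
  \<open>Q\<close> hold for them only up to scalars. \<open>no_line\<close> and
  \<open>no_plane\<close> express irreducibility, a plane being given by the row vector
  \<open>f\<close> vanishing on it.\<close>

locale chiral_lift = special_linear_group K for K :: "('a::{field,finite} ^ 3 ^ 3) monoid" (structure) +
  fixes r :: nat and s :: "nat \<Rightarrow> 'a ^ 3 ^ 3"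
  assumes r: "r > 5"
    and s_closed: "1 \<le> i \<Longrightarrow> i \<le> r - 1 \<Longrightarrow> s i \<in> carrier K"
    and chiral: "gives_chiral_polytope Q r (\<lambda>i. proj (s i))"
    and no_line: "v \<noteq> 0 \<Longrightarrow> \<exists>A \<in> carrier K. \<forall>c. A *v v \<noteq> c *s v"
    and no_plane: "f \<noteq> 0 \<Longrightarrow> \<exists>A \<in> carrier K. \<forall>c. f v* A \<noteq> c *s f"
begin

definition n where "n = r - 1"

lemma n: "n \<ge> 5" using r by (simp add: n_def)

lemma n_le: "n \<le> r - 1" by (simp add: n_def)

abbreviation \<sigma> where "\<sigma> \<equiv> \<lambda>i. proj (s i)"

abbreviation t where "t \<equiv> tau K s"

sublocale P: string_group Q r \<sigma>
  using chiral by unfold_locales (auto simp: gives_chiral_polytope_def)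

lemma t_closed: "1 \<le> i \<Longrightarrow> j \<le> n \<Longrightarrow> t i j \<in> carrier K"
  and proj_t: "1 \<le> i \<Longrightarrow> j \<le> n \<Longrightarrow> proj (t i j) = P.\<tau> i j"
proof -
  have *: "foldr (\<lambda>x y. x \<otimes> y) (map s xs) \<one> \<in> carrier K \<and>
      proj (foldr (\<lambda>x y. x \<otimes> y) (map s xs) \<one>) = foldr (\<lambda>x y. x \<otimes>\<^bsub>Q\<^esub> y) (map \<sigma> xs) \<one>\<^bsub>Q\<^esub>"
    if "set xs \<subseteq> {1..r - 1}" for xs
    using that
    by (induction xs) (auto simp: proj_one mat_1_closed one_K mult_K mult_closed s_closed proj_mult)
  assume "1 \<le> i" "j \<le> n"
  then have "set [i..<Suc j] \<subseteq> {1..r - 1}" by (auto simp: n_def)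
  from *[OF this] show "t i j \<in> carrier K" "proj (t i j) = P.\<tau> i j" unfolding tau_def by auto
qed

lemma s_in: "1 \<le> i \<Longrightarrow> i \<le> n \<Longrightarrow> s i \<in> carrier K"
  by (rule s_closed) (simp_all add: n_def)

lemma t_Suc: "t i (Suc i) = s i ** s (Suc i)"
  by (simp add: tau_def mult_K one_K)

lemma \<tau>_Suc: "1 \<le> i \<Longrightarrow> Suc i \<le> n \<Longrightarrow> P.\<tau> i (Suc i) = \<sigma> i \<otimes>\<^bsub>Q\<^esub> \<sigma> (Suc i)"
  using proj_t[of i "Suc i"] by (simp add: t_Suc proj_mult s_in)

lemma t_same: "t i i = s i"
  by (simp add: tau_def mult_K one_K)

lemma \<sigma>_closed: "1 \<le> i \<Longrightarrow> i \<le> n \<Longrightarrow> \<sigma> i \<in> carrier Q"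
  by (simp add: proj_closed s_in)

lemma first_not_involution: "\<sigma> 1 \<otimes>\<^bsub>Q\<^esub> \<sigma> 1 \<noteq> \<one>\<^bsub>Q\<^esub>"
  using P.first_involution_not_chiral chiral r by (auto simp: gives_chiral_polytope_def)

lemma last_not_involution: "\<sigma> n \<otimes>\<^bsub>Q\<^esub> \<sigma> n \<noteq> \<one>\<^bsub>Q\<^esub>"
  using P.last_involution_not_chiral chiral r by (auto simp: gives_chiral_polytope_def n_def)

text \<open>In \<open>Q\<close>, \<open>\<sigma> i\<close> is \<open>\<tau> i n\<close> times the
  inverse of \<open>\<tau> (Suc i) n\<close>. This family is convenient because each member inverts
  \<open>\<sigma> n\<close> (for \<open>i < n - 1\<close>) or commutes with
  \<open>\<sigma> 1\<close>.\<close>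

lemma generated_by_t:
  assumes H: "subgroup H K" and Z: "scalars K \<subseteq> H" and t: "\<And>i. 1 \<le> i \<Longrightarrow> i \<le> n \<Longrightarrow> t i n \<in> H"
  shows "H = carrier K"
proof (rule subgroup_eq_carrier[OF H Z])
  show "generate Q (\<sigma> ` {1..r - 1}) = carrier Q" using chiral by (simp add: gives_chiral_polytope_def)
  show "\<sigma> ` {1..r - 1} \<subseteq> proj ` H"
  proof safe
    fix i assume "i \<in> {1..r - 1}"
    then have i: "1 \<le> i" "i \<le> n" by (auto simp: n_def)
    show "\<sigma> i \<in> proj ` H"
    proof (cases "i = n")
      case True
      then show ?thesis using t[of n] i by (simp add: t_same)
    next
      case False
      have c: "P.\<tau> (Suc i) n \<in> carrier Q" using i by (intro P.\<tau>_closed) (auto simp: n_def)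
      have "P.\<tau> i n = \<sigma> i \<otimes>\<^bsub>Q\<^esub> P.\<tau> (Suc i) n" using i False by (intro P.\<tau>_Cons) (auto simp: n_def)
      then have "\<sigma> i = P.\<tau> i n \<otimes>\<^bsub>Q\<^esub> inv\<^bsub>Q\<^esub> (P.\<tau> (Suc i) n)"
        using c i by (simp add: Q.m_assoc \<sigma>_closed)
      also have "\<dots> = proj (t i n ** inv (t (Suc i) n))"
        using i False by (simp add: proj_mult t_closed proj_inv proj_t)
      finally show ?thesis
        using t[of i] t[of "Suc i"] i False subgroup.m_closed[OF H, of "t i n" "inv (t (Suc i) n)"]
          subgroup.m_inv_closed[OF H, of "t (Suc i) n"] by (auto simp: mult_K)
    qed
  qed
qed

lemma subgroup_line_stabilizer:
  assumes "v \<noteq> 0"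
  shows "subgroup {A \<in> carrier K. \<exists>c. A *v v = c *s v} K" (is "subgroup ?H K")
proof (rule subgroupI)
  have "mat 1 \<in> ?H" using mat_1_closed by (auto intro: exI[of _ 1])
  then show "?H \<noteq> {}" by blast
  fix A assume "A \<in> ?H"
  then obtain c where A: "A \<in> carrier K" and c: "A *v v = c *s v" by blast
  have v: "c *s (inv A *v v) = v"
    using arg_cong[OF c, of "\<lambda>x. inv A *v x"] inv_left[OF A]
    by (simp add: matrix_vector_mul_assoc vector_scalar_commute)
  then have "c \<noteq> 0" using assms by auto
  then have "inv A *v v = (1 / c) *s v" by (subst (2) v[symmetric]) simp
  then show "inv A \<in> ?H" using A by blast
  fix B assume "B \<in> ?H"
  then obtain d where B: "B \<in> carrier K" and d: "B *v v = d *s v" by blast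
  have "(A ** B) *v v = (d * c) *s v"
    by (simp add: matrix_vector_mul_assoc[symmetric] c d vector_scalar_commute)
  then show "A \<otimes> B \<in> ?H" using mult_closed[OF A B] by (auto simp: mult_K)
qed auto

lemma subgroup_plane_stabilizer:
  assumes "f \<noteq> 0"
  shows "subgroup {A \<in> carrier K. \<exists>c. f v* A = c *s f} K" (is "subgroup ?H K")
proof (rule subgroupI)
  have scale: "(c *s f) v* A = c *s (f v* A)" for c A
    by (simp add: vector_matrix_mult_def vec_eq_iff sum_distrib_left mult_ac)
  have "mat 1 \<in> ?H" using mat_1_closed by (auto intro: exI[of _ 1])
  then show "?H \<noteq> {}" by blast
  fix A assume "A \<in> ?H"
  then obtain c where A: "A \<in> carrier K" and c: "f v* A = c *s f" by blast
  have v: "c *s (f v* inv A) = f"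
    using arg_cong[OF c, of "\<lambda>x. x v* inv A"] inv_right[OF A]
    by (simp add: vector_matrix_mul_assoc scale)
  then have "c \<noteq> 0" using assms by auto
  then have "f v* inv A = (1 / c) *s f" by (subst (2) v[symmetric]) simp
  then show "inv A \<in> ?H" using A by blast
  fix B assume "B \<in> ?H"
  then obtain d where B: "B \<in> carrier K" and d: "f v* B = d *s f" by blast
  have "f v* (A ** B) = (c * d) *s f"
    by (simp add: vector_matrix_mul_assoc[symmetric] c d scale)
  then show "A \<otimes> B \<in> ?H" using mult_closed[OF A B] by (auto simp: mult_K)
qed auto

lemma no_common_line:
  assumes "v \<noteq> 0" and t: "\<And>i. 1 \<le> i \<Longrightarrow> i \<le> n \<Longrightarrow> \<exists>c. t i n *v v = c *s v"
  shows False
proof -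
  have "{A \<in> carrier K. \<exists>c. A *v v = c *s v} = carrier K"
  proof (rule generated_by_t[OF subgroup_line_stabilizer[OF assms(1)]])
    show "scalars K \<subseteq> {A \<in> carrier K. \<exists>c. A *v v = c *s v}"
    proof
      fix z assume "z \<in> scalars K"
      then obtain c where "z \<in> carrier K" "z = mat c" unfolding scalars_def by blast
      then have "z *v v = c *s v" by (simp add: mat_mult_vec)
      then show "z \<in> {A \<in> carrier K. \<exists>c. A *v v = c *s v}" using \<open>z \<in> carrier K\<close> by blast
    qed
  qed (use t t_closed in blast)
  then show False using no_line[OF assms(1)] by blast
qed

lemma no_common_plane:
  assumes "f \<noteq> 0" and t: "\<And>i. 1 \<le> i \<Longrightarrow> i \<le> n \<Longrightarrow> \<exists>c. f v* t i n = c *s f"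
  shows False
proof -
  have "{A \<in> carrier K. \<exists>c. f v* A = c *s f} = carrier K"
  proof (rule generated_by_t[OF subgroup_plane_stabilizer[OF assms(1)]])
    show "scalars K \<subseteq> {A \<in> carrier K. \<exists>c. f v* A = c *s f}"
    proof
      fix z assume "z \<in> scalars K"
      then obtain c where "z \<in> carrier K" "z = mat c" unfolding scalars_def by blast
      then have "f v* z = c *s f" by (simp add: vec_mult_mat)
      then show "z \<in> {A \<in> carrier K. \<exists>c. f v* A = c *s f}" using \<open>z \<in> carrier K\<close> by blast
    qed
  qed (use t t_closed in blast)
  then show False using no_plane[OF assms(1)] by blast
qed

lemma \<sigma>_commute: "1 \<le> a \<Longrightarrow> a + 3 \<le> b \<Longrightarrow> b \<le> n \<Longrightarrow> \<sigma> a \<otimes>\<^bsub>Q\<^esub> \<sigma> b = \<sigma> b \<otimes>\<^bsub>Q\<^esub> \<sigma> a"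
  using P.\<sigma>_commute[of a b] by (simp add: n_def)

lemma \<tau>_square: "1 \<le> i \<Longrightarrow> i < j \<Longrightarrow> j \<le> n \<Longrightarrow> P.\<tau> i j \<otimes>\<^bsub>Q\<^esub> P.\<tau> i j = \<one>\<^bsub>Q\<^esub>"
  using P.\<tau>_square[of i j] by (simp add: n_def)

lemma t_commute:
  assumes "1 \<le> i" "i < j" "j \<le> n" "B \<in> carrier K"
    and "P.\<tau> i j \<otimes>\<^bsub>Q\<^esub> proj B = proj B \<otimes>\<^bsub>Q\<^esub> P.\<tau> i j"
  shows "t i j ** B = B ** t i j"
  using assms by (intro involution_commute) (auto simp: t_closed proj_t \<tau>_square)

text \<open>Since \<open>n\<close> is at least 5, both factors of \<open>\<tau> 1 2\<close> commute
  with \<open>\<sigma> n\<close> in \<open>Q\<close>. The product is an involution, so its lift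
  commutes exactly, although the factors are separately known to commute only up to a scalar. The
  other end is symmetric.\<close>

lemma t_commute_last: "t 1 2 ** s n = s n ** t 1 2"
  and t_commute_first: "t (n - 1) n ** s 1 = s 1 ** t (n - 1) n"
proof -
  note c = \<sigma>_closed[of 1] \<sigma>_closed[of 2] \<sigma>_closed[of n] \<sigma>_closed[of "n - 1"]
  have "P.\<tau> 1 2 = \<sigma> 1 \<otimes>\<^bsub>Q\<^esub> \<sigma> 2"
    using n \<tau>_Suc[of 1] by (simp add: numeral_2_eq_2)
  moreover have "\<sigma> 1 \<otimes>\<^bsub>Q\<^esub> \<sigma> n = \<sigma> n \<otimes>\<^bsub>Q\<^esub> \<sigma> 1" "\<sigma> 2 \<otimes>\<^bsub>Q\<^esub> \<sigma> n = \<sigma> n \<otimes>\<^bsub>Q\<^esub> \<sigma> 2"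
    using n \<sigma>_commute[of 1 n] \<sigma>_commute[of 2 n] by simp_all
  ultimately show "t 1 2 ** s n = s n ** t 1 2"
    using n Q.commute_mult[of "\<sigma> 1" "\<sigma> 2" "\<sigma> n"] c by (intro t_commute) (auto simp: s_in)
  have "Suc (n - 1) = n" using n by simp
  then have "P.\<tau> (n - 1) n = \<sigma> (n - 1) \<otimes>\<^bsub>Q\<^esub> \<sigma> n" using n \<tau>_Suc[of "n - 1"] by simp
  moreover have "\<sigma> n \<otimes>\<^bsub>Q\<^esub> \<sigma> 1 = \<sigma> 1 \<otimes>\<^bsub>Q\<^esub> \<sigma> n" "\<sigma> (n - 1) \<otimes>\<^bsub>Q\<^esub> \<sigma> 1 = \<sigma> 1 \<otimes>\<^bsub>Q\<^esub> \<sigma> (n - 1)"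
    using n \<sigma>_commute[of 1 n] \<sigma>_commute[of 1 "n - 1"] by simp_all
  ultimately show "t (n - 1) n ** s 1 = s 1 ** t (n - 1) n"
    using n Q.commute_mult[of "\<sigma> (n - 1)" "\<sigma> n" "\<sigma> 1"] c by (intro t_commute) (auto simp: s_in)
qed

text \<open>Since \<open>A\<close> squares to one in \<open>Q\<close>, the inversion can be
  rewritten without inverses, so that lifting costs a single scalar.\<close>

lemma inverted_lift:
  assumes A: "A \<in> carrier K" and B: "B \<in> carrier K"
    and sq: "proj A \<otimes>\<^bsub>Q\<^esub> proj A = \<one>\<^bsub>Q\<^esub>"
    and inv: "proj A \<otimes>\<^bsub>Q\<^esub> proj B \<otimes>\<^bsub>Q\<^esub> proj A = inv\<^bsub>Q\<^esub> (proj B)"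
  shows "\<exists>c. B ** A ** B = mat c ** A"
proof -
  note c = proj_closed[OF A] proj_closed[OF B]
  have 1: "(proj A \<otimes>\<^bsub>Q\<^esub> proj B \<otimes>\<^bsub>Q\<^esub> proj A) \<otimes>\<^bsub>Q\<^esub> proj B = \<one>\<^bsub>Q\<^esub>" using c by (simp add: inv)
  have "proj B \<otimes>\<^bsub>Q\<^esub> proj A \<otimes>\<^bsub>Q\<^esub> proj B
      = (proj A \<otimes>\<^bsub>Q\<^esub> proj A) \<otimes>\<^bsub>Q\<^esub> (proj B \<otimes>\<^bsub>Q\<^esub> proj A \<otimes>\<^bsub>Q\<^esub> proj B)"
    using c by (simp add: sq)
  also have "\<dots> = proj A \<otimes>\<^bsub>Q\<^esub> ((proj A \<otimes>\<^bsub>Q\<^esub> proj B \<otimes>\<^bsub>Q\<^esub> proj A) \<otimes>\<^bsub>Q\<^esub> proj B)"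
    using c by (simp add: Q.m_assoc)
  also have "\<dots> = proj A" using c by (simp add: 1)
  finally have "proj (B ** A ** B) = proj A" by (simp add: proj_mult mult_closed A B)
  then show ?thesis using proj_eq_iff[of "B ** A ** B" A] A B by (simp add: mult_closed)
qed

lemma t_inverts_last:
  assumes "1 \<le> i" "Suc i < n"
  shows "\<exists>c. s n ** t i n ** s n = mat c ** t i n"
  using assms n P.\<tau>_inverts_last[of i n, OF _ _ n_le]
  by (intro inverted_lift) (simp_all add: t_closed s_in proj_t \<tau>_square)

lemma t_inverts_first: "\<exists>c. s 1 ** t 1 n ** s 1 = mat c ** t 1 n"
  using n P.\<tau>_inverts_first[of 1 n, OF _ _ n_le]
  by (intro inverted_lift) (simp_all add: t_closed s_in proj_t \<tau>_square)

lemma right_cancel: "A \<in> carrier K \<Longrightarrow> X ** A = Y ** A \<Longrightarrow> X = Y"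
  by (metis inv_right matrix_mul_assoc matrix_mul_rid)

lemma square_scalar_involution:
  assumes "1 \<le> i" "i \<le> n" "s i ** s i = mat c"
  shows "\<sigma> i \<otimes>\<^bsub>Q\<^esub> \<sigma> i = \<one>\<^bsub>Q\<^esub>"
proof -
  have i: "s i \<in> carrier K" using assms by (simp add: s_in)
  have "proj (s i ** s i) = \<one>\<^bsub>Q\<^esub>" using proj_one_scalar[OF mult_closed[OF i i]] assms(3) by blast
  then show ?thesis by (simp only: proj_mult[OF i i])
qed

lemma square_not_scalar: "s 1 ** s 1 \<noteq> mat c" "s n ** s n \<noteq> mat c"
proof -
  have n1: "1 \<le> n" using n by simp
  show "s 1 ** s 1 \<noteq> mat c"
    using square_scalar_involution[OF order_refl n1] first_not_involution by blast
  show "s n ** s n \<noteq> mat c"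
    using square_scalar_involution[OF n1 order_refl] last_not_involution by blast
qed

text \<open>If the lifts commute, the centralizers of both have noncommuting elements, so both lifts are scalar
  plus rank one, in fact multiples of transvections. Two commuting transvections share their centre or their
  axis, which is then invariant under every \<open>\<tau>\<^sub>i\<^sub>n\<close> and hence under the whole group.\<close>

lemma lifts_not_commute: "s 1 ** s n \<noteq> s n ** s 1"
proof
  assume comm: "s 1 ** s n = s n ** s 1"
  have sK: "s 1 \<in> carrier K" "s 2 \<in> carrier K" "s (n - 1) \<in> carrier K" "s n \<in> carrier K"
    using n by (auto intro!: s_in)
  have s_prev: "t (n - 1) n = s (n - 1) ** s n" using n t_Suc[of "n - 1"] by simp
  have ip: "intersection_property Q r \<sigma>" using chiral by (simp add: gives_chiral_polytope_def)
  \<comment> \<open>\<open>s 1 ** s 2\<close> commutes with \<open>s n\<close> exactly, and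
    \<open>s 1\<close> does by assumption, so \<open>s 1\<close> can be cancelled.
    \<open>comm3\<close> is the mirror image.\<close>
  have comm2: "s 2 ** s n = s n ** s 2"
  proof (rule matrix_left_cancel[OF det_nz[OF sK(1)]])
    have "s 1 ** s 2 ** s n = s n ** s 1 ** s 2"
      using t_commute_last t_Suc[of 1] by (simp add: numeral_2_eq_2 matrix_mul_assoc)
    then show "s 1 ** (s 2 ** s n) = s 1 ** (s n ** s 2)" by (simp only: comm matrix_mul_assoc)
  qed
  have comm3: "s (n - 1) ** s 1 = s 1 ** s (n - 1)"
  proof (rule right_cancel[OF sK(4)])
    have "s (n - 1) ** s n ** s 1 = s 1 ** s (n - 1) ** s n"
      using t_commute_first by (simp only: s_prev matrix_mul_assoc)
    then show "s (n - 1) ** s 1 ** s n = s 1 ** s (n - 1) ** s n"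
      by (simp only: comm matrix_mul_assoc[symmetric])
  qed
  have "\<not> cyclic_vector (s n) z" for z
  proof
    assume "cyclic_vector (s n) z"
    then have "s 1 ** s 2 = s 2 ** s 1" by (rule cyclic_imp_centralizer_abelian[OF _ comm comm2])
    then have "\<sigma> 1 \<otimes>\<^bsub>Q\<^esub> \<sigma> (Suc 1) = \<sigma> (Suc 1) \<otimes>\<^bsub>Q\<^esub> \<sigma> 1"
      using sK by (simp add: numeral_2_eq_2 flip: proj_mult)
    from P.adjacent_commute_imp_involution(1)[OF ip _ _ this] show False
      using first_not_involution r by simp
  qed
  then obtain l v f where sn: "s n = mat l + outer v f" using no_cyclic_imp_rank_one by blast
  have "\<not> cyclic_vector (s 1) z" for z
  proof
    assume "cyclic_vector (s 1) z"
    then have "s (n - 1) ** s n = s n ** s (n - 1)"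
      by (rule cyclic_imp_centralizer_abelian[OF _ comm3 comm[symmetric]])
    moreover have "Suc (n - 1) = n" using n by simp
    ultimately have "\<sigma> (n - 1) \<otimes>\<^bsub>Q\<^esub> \<sigma> (Suc (n - 1)) = \<sigma> (Suc (n - 1)) \<otimes>\<^bsub>Q\<^esub> \<sigma> (n - 1)"
      using sK by (simp flip: proj_mult)
    moreover have "1 \<le> n - 1" "Suc (n - 1) \<le> r - 1" using n n_le by auto
    ultimately have "\<sigma> (Suc (n - 1)) \<otimes>\<^bsub>Q\<^esub> \<sigma> (Suc (n - 1)) = \<one>\<^bsub>Q\<^esub>"
      using P.adjacent_commute_imp_involution(2)[OF ip] by blast
    then show False using last_not_involution by (simp only: \<open>Suc (n - 1) = n\<close>)
  qed
  then obtain l' v' f' where s1: "s 1 = mat l' + outer v' f'" using no_cyclic_imp_rank_one by blast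
  have vf: "v \<noteq> 0" "f \<noteq> 0"
  proof -
    have "outer v f \<noteq> 0"
    proof
      assume "outer v f = 0"
      then have "s n ** s n = mat (l * l)" by (simp add: sn mat_mult_mat)
      then show False using square_not_scalar by blast
    qed
    then show "v \<noteq> 0" "f \<noteq> 0" by (auto simp: outer_eq_0_iff)
  qed
  have vf': "v' \<noteq> 0" "f' \<noteq> 0"
  proof -
    have "outer v' f' \<noteq> 0"
    proof
      assume "outer v' f' = 0"
      then have "s 1 ** s 1 = mat (l' * l')" unfolding s1 by (simp add: mat_mult_mat)
      then show False using square_not_scalar by blast
    qed
    then show "v' \<noteq> 0" "f' \<noteq> 0" by (auto simp: outer_eq_0_iff)
  qed
  \<comment> \<open>For \<open>i < n - 1\<close> the matrix \<open>t i n\<close> inverts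
    \<open>s n\<close> up to a scalar and thus preserves \<open>v\<close> and \<open>f\<close>; for
    \<open>i = n - 1\<close> and \<open>i = n\<close> it commutes with \<open>s 1\<close> and
    preserves \<open>v'\<close> and \<open>f'\<close>.\<close>
  have inverted: "(\<exists>a. t i n *v v = a *s v) \<and> (\<exists>b. f v* t i n = b *s f) \<and> dot f v = 0"
    if i: "1 \<le> i" "Suc i < n" for i
  proof -
    obtain c where c: "s n ** t i n ** s n = mat c ** t i n" using t_inverts_last[OF i] by blast
    have "det (t i n) \<noteq> 0" using i t_closed by (intro det_nz) auto
    note inv = rank_one_inverted[OF sn vf this det_nz[OF sK(4)] c]
    then show ?thesis using square_not_scalar(2) by blast
  qed
  have commuting: "(\<exists>a. t i n *v v' = a *s v') \<and> (\<exists>b. f' v* t i n = b *s f')"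
    if i: "i \<le> n" "\<not> Suc i < n" for i
  proof -
    have "i = n - 1 \<or> i = n" using i by auto
    then have "s 1 ** t i n = mat 1 ** (t i n ** s 1)" using t_commute_first comm by (auto simp: t_same)
    moreover have "det (t i n) \<noteq> 0" using i n t_closed by (intro det_nz) auto
    ultimately show ?thesis using rank_one_commuting[OF s1 vf' _ det_nz[OF sK(1)]] by blast
  qed
  have dot: "dot f v = 0" using inverted[of 1] n by simp
  have dot': "dot f' v' = 0"
  proof -
    obtain c where c: "s 1 ** t 1 n ** s 1 = mat c ** t 1 n" using t_inverts_first by blast
    have "det (t 1 n) \<noteq> 0" using t_closed by (intro det_nz) auto
    from rank_one_inverted(3)[OF s1 vf' this det_nz[OF sK(1)] c] show ?thesis
      using square_not_scalar(1) by blast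
  qed
  \<comment> \<open>Only the rank one parts matter, as scalars commute. In the resulting equality a
    nonzero \<open>dot f' v\<close> would make \<open>f'\<close> a multiple of \<open>f\<close>,
    against \<open>dot f v = 0\<close>; hence both mixed products vanish and
    \<open>annihilator_parallel\<close> applies.\<close>
  have "outer v' f' ** outer v f = outer v f ** outer v' f'"
  proof -
    have "(mat l' + outer v' f') ** (mat l + outer v f) = (mat l + outer v f) ** (mat l' + outer v' f')"
      using comm by (simp only: s1 sn)
    then show ?thesis
      by (simp add: matrix_add_ldistrib matrix_add_rdistrib mat_mult_mat mult.commute[of l l']
          mat_commute[of l "outer v' f'"] mat_commute[of l' "outer v f"])
  qed
  then have eq: "outer (dot f' v *s v') f = outer (dot f v' *s v) f'" by (simp add: outer_mult_outer)
  have dot_scale: "dot (c *s g) x = c * dot g x" "dot g (c *s x) = c * dot g x" for c and g x :: "'a ^ 3"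
    by (simp_all add: dot_def sum_distrib_left mult_ac)
  have 1: "dot f' v = 0"
  proof (rule ccontr)
    assume "dot f' v \<noteq> 0"
    then obtain c where "f' = c *s f" using outer_eq_parallel(2)[OF eq] vf vf' by auto
    then show False using \<open>dot f' v \<noteq> 0\<close> dot by (simp add: dot_scale)
  qed
  have 2: "dot f v' = 0"
  proof (rule ccontr)
    assume "dot f v' \<noteq> 0"
    then have "dot f v' *s v \<noteq> 0" using vf by simp
    then have "outer (dot f v' *s v) f' \<noteq> 0" using vf' by (simp add: outer_eq_0_iff)
    moreover have "outer (dot f' v *s v') f = 0" using 1 by (simp add: outer_eq_0_iff)
    ultimately show False using eq by simp
  qed
  consider c where "v' = c *s v" | c where "f' = c *s f"
    using annihilator_parallel[OF vf dot 2 1 dot'] by blast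
  then show False
  proof cases
    case 1
    have "c \<noteq> 0" using 1 vf' by auto
    have "\<exists>a. t i n *v v = a *s v" if i: "1 \<le> i" "i \<le> n" for i
    proof (cases "Suc i < n")
      case False
      then obtain a where "t i n *v v' = a *s v'" using commuting i by blast
      then have "c *s (t i n *v v) = c *s (a *s v)" by (simp add: 1 vector_scalar_commute mult.commute)
      then show ?thesis using \<open>c \<noteq> 0\<close> by (metis vec.scale_cancel_left)
    qed (use inverted i in blast)
    then show False using no_common_line[OF vf(1)] by blast
  next
    case 2
    have "c \<noteq> 0" using 2 vf' by auto
    have "\<exists>a. f v* t i n = a *s f" if i: "1 \<le> i" "i \<le> n" for i
    proof (cases "Suc i < n")
      case False
      then obtain a where a: "f' v* t i n = a *s f'" using commuting i by blast
      have "(c *s f) v* t i n = c *s (f v* t i n)"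
        by (simp add: vector_matrix_mult_def vec_eq_iff sum_distrib_left mult_ac)
      then have "c *s (f v* t i n) = c *s (a *s f)" using a by (simp add: 2 mult.commute)
      then show ?thesis using \<open>c \<noteq> 0\<close> by (metis vec.scale_cancel_left)
    qed (use inverted i in blast)
    then show False using no_common_plane[OF vf(2)] by blast
  qed
qed

section \<open>Lifts that commute only up to a nontrivial cube root of unity\<close>

lemma t_Cons: "i < k \<Longrightarrow> t i k = s i ** t (Suc i) k"
  by (simp add: tau_def mult_K upt_conv_Cons del: upt_Suc)

lemma \<tau>_Cons: "1 \<le> i \<Longrightarrow> i < k \<Longrightarrow> k \<le> n \<Longrightarrow> P.\<tau> i k = \<sigma> i \<otimes>\<^bsub>Q\<^esub> P.\<tau> (Suc i) k"
  using P.\<tau>_Cons[of i k] by (simp add: n_def)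

lemma \<tau>_closed: "1 \<le> i \<Longrightarrow> k \<le> n \<Longrightarrow> P.\<tau> i k \<in> carrier Q"
  using P.\<tau>_closed[of i k] by (simp add: n_def)

text \<open>For \<open>n\<close> at least 6 the generators 1, 2 and 3 all commute with
  \<open>\<sigma> n\<close> in \<open>Q\<close>, so the lifts of the involutions
  \<open>\<tau> 1 3\<close> and \<open>\<tau> 2 3\<close> commute with \<open>s n\<close> exactly.
  Then so does their quotient \<open>s 1\<close>, which \<open>lifts_not_commute\<close>
  excludes.\<close>

lemma rank_six: "n = 5"
proof (rule ccontr)
  assume "n \<noteq> 5"
  then have n6: "n \<ge> 6" using n by simp
  note c = \<sigma>_closed[of 1] \<sigma>_closed[of 2] \<sigma>_closed[of 3] \<sigma>_closed[of n]
  have 3: "P.\<tau> 2 3 = \<sigma> 2 \<otimes>\<^bsub>Q\<^esub> \<sigma> 3" using n6 \<tau>_Suc[of 2] by simp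
  have 2: "P.\<tau> 1 3 = \<sigma> 1 \<otimes>\<^bsub>Q\<^esub> P.\<tau> 2 3" using n6 \<tau>_Cons[of 1 3] by (simp add: numeral_2_eq_2)
  have c23: "P.\<tau> 2 3 \<otimes>\<^bsub>Q\<^esub> \<sigma> n = \<sigma> n \<otimes>\<^bsub>Q\<^esub> P.\<tau> 2 3"
    unfolding 3 using c n6 by (intro Q.commute_mult) (simp_all add: \<sigma>_commute)
  have c13: "P.\<tau> 1 3 \<otimes>\<^bsub>Q\<^esub> \<sigma> n = \<sigma> n \<otimes>\<^bsub>Q\<^esub> P.\<tau> 1 3"
    unfolding 2 using c n6 \<sigma>_commute[of 1 n] by (intro Q.commute_mult) (simp_all add: \<tau>_closed c23)
  have sK: "s 1 \<in> carrier K" "s n \<in> carrier K" "t 2 3 \<in> carrier K"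
    using n6 by (auto intro!: s_in t_closed)
  have t23: "t 2 3 ** s n = s n ** t 2 3" using n6 sK by (intro t_commute c23) auto
  have "t 1 3 ** s n = s n ** t 1 3" using n6 sK by (intro t_commute c13) auto
  moreover have "t 1 3 = s 1 ** t 2 3" using t_Cons[of 1 3] by (simp add: numeral_2_eq_2)
  ultimately have "s 1 ** t 2 3 ** s n = s n ** s 1 ** t 2 3" by (simp only: matrix_mul_assoc)
  then have "s 1 ** s n ** t 2 3 = s n ** s 1 ** t 2 3"
    by (simp only: matrix_mul_assoc[symmetric] t23)
  then have "s 1 ** s n = s n ** s 1" by (rule right_cancel[OF sK(3)])
  with lifts_not_commute show False by blast
qed

text \<open>The inverse transpose map, twisted by a form \<open>M\<close>; \<open>M'\<close> stands
  for the inverse of \<open>M\<close>.\<close>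

definition contragredient where "contragredient M M' A = M ** transpose (inv A) ** M'" for M M' :: "'a ^ 3 ^ 3"

lemma contragredient_mult:
  assumes "M' ** M = mat 1" "A \<in> carrier K" "B \<in> carrier K"
  shows "contragredient M M' (A ** B) = contragredient M M' A ** contragredient M M' B"
proof -
  have "inv (A ** B) = inv B ** inv A" using inv_mult_group[OF assms(2,3)] by (simp add: mult_K)
  then have "contragredient M M' (A ** B) = M ** transpose (inv A) ** mat 1 ** transpose (inv B) ** M'"
    by (simp add: contragredient_def matrix_transpose_mul matrix_mul_assoc)
  then show ?thesis by (simp add: assms(1)[symmetric] contragredient_def matrix_mul_assoc)
qed

text \<open>\<open>X\<close> is a similitude of the form with multiplier \<open>x\<close>, so the
  map divides \<open>X\<close> by \<open>x\<close>; determinants force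
  \<open>x ^ 3 = 1\<close>.\<close>

lemma contragredient_preserved:
  assumes M: "M ** M' = mat 1" "det M \<noteq> 0" and X: "X \<in> carrier K"
    and form: "X ** M ** transpose X = mat x ** M"
  shows "\<exists>c. c ^ 3 = 1 \<and> contragredient M M' X = mat c ** X"
proof -
  have "x ^ 3 = 1"
    using arg_cong[OF form, of det] det_K[OF X] M(2) by (simp add: det_mul det_mat det_transpose)
  then have x: "x \<noteq> 0" by auto
  have "transpose X ** transpose (inv X) = mat 1"
    by (simp add: matrix_transpose_mul[symmetric] inv_left[OF X])
  then have "X ** M = X ** M ** transpose X ** transpose (inv X)"
    by (simp add: matrix_mul_assoc[symmetric])
  also have "\<dots> = mat x ** (M ** transpose (inv X))" by (simp add: form matrix_mul_assoc)
  finally have "mat (1 / x) ** (X ** M) = M ** transpose (inv X)"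
    using x by (simp add: matrix_mul_assoc mat_mult_mat)
  then have "contragredient M M' X = mat (1 / x) ** (X ** M) ** M'" by (simp add: contragredient_def)
  also have "\<dots> = mat (1 / x) ** X" by (simp add: matrix_mul_assoc[symmetric] M)
  finally show ?thesis using \<open>x ^ 3 = 1\<close> x by (intro exI[of _ "1 / x"]) (simp add: power_divide)
qed

text \<open>\<open>X\<close> is self-adjoint for the form, so the twisted transpose does nothing and
  only the inverse remains.\<close>

lemma contragredient_inverted:
  assumes M: "M ** M' = mat 1" and X: "X \<in> carrier K"
    and form: "X ** M = M ** transpose X"
  shows "contragredient M M' X = inv X"
proof -
  have "transpose X ** transpose (inv X) = mat 1"
    by (simp add: matrix_transpose_mul[symmetric] inv_left[OF X])
  then have "X ** M ** transpose (inv X) = M" by (simp add: form matrix_mul_assoc[symmetric])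
  then have "inv X ** M = (inv X ** X) ** M ** transpose (inv X)"
    by (simp only: matrix_mul_assoc[symmetric])
  then have "contragredient M M' X = inv X ** M ** M'" by (simp add: inv_left[OF X] contragredient_def)
  then show ?thesis by (simp add: matrix_mul_assoc[symmetric] M)
qed

lemma contragredient_scalar:
  assumes M: "M ** M' = mat 1" and c: "mat c \<in> carrier K"
  shows "\<exists>d. contragredient M M' (mat c) = mat d \<and> mat d \<in> carrier K"
proof -
  have "inv (mat c) \<in> scalars K" using scalarsI[OF c] by (rule Z.m_inv_closed)
  then obtain d where d: "inv (mat c) = mat d" "mat d \<in> carrier K" unfolding scalars_def by auto
  have "contragredient M M' (mat c) = mat d ** (M ** M')"
    by (simp add: contragredient_def d transpose_mat mat_commute[of d M, symmetric] matrix_mul_assoc)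
  then show ?thesis using d M by auto
qed

lemma contragredient_inj:
  assumes "M ** M' = mat 1" "M' ** M = mat 1"
  shows "inj_on (contragredient M M') (carrier K)"
proof (rule inj_onI)
  fix A B assume A: "A \<in> carrier K" and B: "B \<in> carrier K" and eq: "contragredient M M' A = contragredient M M' B"
  have un: "M' ** contragredient M M' A ** M = transpose (inv A)" for A
  proof -
    have "M' ** contragredient M M' A ** M = (M' ** M) ** transpose (inv A) ** (M' ** M)"
      by (simp only: contragredient_def matrix_mul_assoc)
    then show ?thesis by (simp add: assms)
  qed
  have "transpose (inv A) = transpose (inv B)" using un[of A] un[of B] eq by simp
  then have "inv A = inv B" by (metis transpose_transpose)
  then show "A = B" using A B by (metis inv_inv)
qed

text \<open>With the form from \<open>invariant_form\<close>, the contragredient map fixes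
  \<open>s 1\<close>, \<open>t 1 2\<close>, \<open>t 4 5\<close> and \<open>t 1 5\<close> modulo
  scalars and inverts \<open>s 5\<close>. Once it is known to preserve \<open>K\<close>, it induces
  an automorphism of \<open>Q\<close>, and composing with conjugation by \<open>\<tau> 1 5\<close>
  violates chirality.\<close>

lemma chiral_lift_impossible: False
proof -
  note n5 = rank_six
  have r6: "r = 6" using n5 r by (simp add: n_def)
  have sK: "s 1 \<in> carrier K" "s 2 \<in> carrier K" "s 5 \<in> carrier K"
    using n5 by (auto intro!: s_in)
  have tK: "t 1 2 \<in> carrier K" "t 4 5 \<in> carrier K" "t 1 5 \<in> carrier K"
    using n5 by (auto intro!: t_closed)
  have "\<sigma> 1 \<otimes>\<^bsub>Q\<^esub> \<sigma> 5 = \<sigma> 5 \<otimes>\<^bsub>Q\<^esub> \<sigma> 1" using \<sigma>_commute[of 1 5] n5 by simp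
  then obtain \<omega> where \<omega>: "s 1 ** s 5 = mat \<omega> ** (s 5 ** s 1)" "\<omega> ^ 3 = 1"
    using proj_commute[OF sK(1,3)] by blast
  have \<omega>1: "\<omega> \<noteq> 1" using lifts_not_commute \<omega>(1) n5 by auto
  have inv2: "\<exists>d. t i j ** t i j = mat d" "\<nexists>c. t i j = mat c" if "1 \<le> i" "i < j" "j \<le> 5" for i j
  proof -
    have T: "t i j \<in> carrier K" using that n5 by (intro t_closed) auto
    have "proj (t i j ** t i j) = \<one>\<^bsub>Q\<^esub>"
      using that n5 \<tau>_square[of i j] by (simp only: proj_mult[OF T T] proj_t)
    then show "\<exists>d. t i j ** t i j = mat d" using proj_one_scalar[OF mult_closed[OF T T]] by blast
    have "proj (t i j) \<noteq> \<one>\<^bsub>Q\<^esub>"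
      using that n5 P.\<tau>_neq_one[of i j] n_le by (simp add: proj_t)
    then show "\<nexists>c. t i j = mat c" using proj_one_scalar[OF T] by blast
  qed
  obtain d where d: "t 1 2 ** t 1 2 = mat d" using inv2(1)[of 1 2] by auto
  obtain d4 where d4: "t 4 5 ** t 4 5 = mat d4" using inv2(1)[of 4 5] by auto
  obtain c where c: "s 5 ** t 1 5 ** s 5 = mat c ** t 1 5" using t_inverts_last[of 1] n5 by auto
  define g where "g = P.\<tau> 1 5"
  have g: "g \<in> carrier Q" "g \<otimes>\<^bsub>Q\<^esub> g = \<one>\<^bsub>Q\<^esub>" unfolding g_def using n5 by (simp_all add: \<tau>_closed \<tau>_square)
  \<comment> \<open>The value 4 is left out because the complementary factor would be
    \<open>\<sigma> 5\<close>, which is not an involution. Correcting the effect on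
    \<open>\<tau> 1 4\<close> is the purpose of \<phi>.\<close>
  have conj_prefix: "g \<otimes>\<^bsub>Q\<^esub> P.\<tau> 1 i \<otimes>\<^bsub>Q\<^esub> g = P.\<tau> 1 i" if "i = 2 \<or> i = 3" for i
    unfolding g_def using that n5 n_le by (intro P.conj_\<tau>_prefix \<tau>_square) auto
  have swap: "g \<otimes>\<^bsub>Q\<^esub> x = x \<otimes>\<^bsub>Q\<^esub> g" if "g \<otimes>\<^bsub>Q\<^esub> x \<otimes>\<^bsub>Q\<^esub> g = x" "x \<in> carrier Q" for x
  proof -
    have "(g \<otimes>\<^bsub>Q\<^esub> x \<otimes>\<^bsub>Q\<^esub> g) \<otimes>\<^bsub>Q\<^esub> g = g \<otimes>\<^bsub>Q\<^esub> x" using that(2) g by (simp add: Q.m_assoc)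
    then show ?thesis using that(1) by simp
  qed
  have g12: "g \<otimes>\<^bsub>Q\<^esub> P.\<tau> 1 2 = P.\<tau> 1 2 \<otimes>\<^bsub>Q\<^esub> g" using n5 by (intro swap conj_prefix) (auto intro!: \<tau>_closed)
  have g13: "g \<otimes>\<^bsub>Q\<^esub> P.\<tau> 1 3 = P.\<tau> 1 3 \<otimes>\<^bsub>Q\<^esub> g" using n5 by (intro swap conj_prefix) (auto intro!: \<tau>_closed)
  have t12: "t 1 2 ** t 1 5 = t 1 5 ** t 1 2"
    using n5 g12 by (intro t_commute) (simp_all add: t_closed proj_t g_def)
  have g345: "g = P.\<tau> 1 3 \<otimes>\<^bsub>Q\<^esub> P.\<tau> 4 5"
    unfolding g_def using P.\<tau>_append[of 1 3 5] n5 n_le by simp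
  have c3: "P.\<tau> 1 3 \<in> carrier Q" "P.\<tau> 4 5 \<in> carrier Q" "P.\<tau> 1 4 \<in> carrier Q" "\<sigma> 5 \<in> carrier Q" "\<sigma> 1 \<in> carrier Q"
    using n5 by (auto intro!: \<tau>_closed \<sigma>_closed)
  have sq3: "P.\<tau> 1 3 \<otimes>\<^bsub>Q\<^esub> P.\<tau> 1 3 = \<one>\<^bsub>Q\<^esub>" "P.\<tau> 4 5 \<otimes>\<^bsub>Q\<^esub> P.\<tau> 4 5 = \<one>\<^bsub>Q\<^esub>" "P.\<tau> 1 4 \<otimes>\<^bsub>Q\<^esub> P.\<tau> 1 4 = \<one>\<^bsub>Q\<^esub>"
    using n5 by (simp_all add: \<tau>_square)
  have t45_13: "P.\<tau> 1 3 = g \<otimes>\<^bsub>Q\<^esub> P.\<tau> 4 5" using c3 sq3 by (simp add: g345 Q.m_assoc)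
  have "P.\<tau> 4 5 = P.\<tau> 1 3 \<otimes>\<^bsub>Q\<^esub> g"
    using c3 sq3 by (simp add: g345 Q.m_assoc[symmetric])
  then have "P.\<tau> 4 5 \<otimes>\<^bsub>Q\<^esub> g = g \<otimes>\<^bsub>Q\<^esub> P.\<tau> 4 5"
    using c3 g g13 by (simp add: Q.m_assoc[symmetric])
  then have t45: "t 4 5 ** t 1 5 = t 1 5 ** t 4 5"
    using n5 by (intro t_commute) (simp_all add: t_closed proj_t g_def)
  have tl: "t 1 2 ** s 5 = s 5 ** t 1 2" "t 4 5 ** s 1 = s 1 ** t 4 5"
    using t_commute_last t_commute_first n5 by auto
  obtain M where M: "det M \<noteq> 0"
      "\<And>X. X \<in> {s 1, t 1 2, t 4 5, t 1 5} \<Longrightarrow> \<exists>x. X ** M ** transpose X = mat x ** M"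
      "s 5 ** M = M ** transpose (s 5)"
    using invariant_form[OF det_nz[OF sK(1)] det_nz[OF sK(3)] det_nz[OF tK(3)] \<omega>(1) \<omega>1 \<omega>(2)
        d tl(1) _ d4 tl(2) _ c t12 t45] inv2(2)[of 1 2] inv2(2)[of 4 5] by auto
  obtain M' where M': "M ** M' = mat 1" "M' ** M = mat 1"
    using M(1) invertible_det_nz[of M] unfolding invertible_def by blast
  let ?\<Psi> = "contragredient M M'"
  have pres: "\<exists>c. c ^ 3 = 1 \<and> ?\<Psi> X = mat c ** X" if "X \<in> {s 1, t 1 2, t 4 5, t 1 5}" for X
    using M(2)[OF that] that sK tK contragredient_preserved[OF M'(1) M(1)] by blast
  \<comment> \<open>The map multiplies some generators by cube roots of unity, whose scalar matrices
    must lie in \<open>K\<close>. The scalar \<omega> does, being a product of lifts and their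
    inverses, and every cube root of unity is a power of \<omega>.\<close>
  have root_in: "mat c \<in> carrier K" if "c ^ 3 = 1" for c
  proof -
    have "s 1 ** s 5 ** inv (s 5 ** s 1) = mat \<omega> ** ((s 5 ** s 1) ** inv (s 5 ** s 1))"
      by (simp only: \<omega>(1) matrix_mul_assoc)
    then have "mat \<omega> = s 1 ** s 5 ** inv (s 5 ** s 1)"
      by (simp only: inv_right[OF mult_closed[OF sK(3,1)]] matrix_mul_rid)
    then have w: "mat \<omega> \<in> carrier K" using sK by (simp add: mult_closed)
    then have w2: "mat (\<omega> * \<omega>) \<in> carrier K" using mult_closed[OF w w] by (simp add: mat_mult_mat)
    have 3: "\<omega> * (\<omega> * \<omega>) = 1" using \<omega>(2) by (simp add: power3_eq_cube mult.assoc)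
    have sum: "\<omega> * \<omega> = - \<omega> - 1"
      using third_root_facts(4)[OF \<omega>(2) \<omega>1] by (simp add: power2_eq_square algebra_simps eq_neg_iff_add_eq_0)
    have "(c - 1) * ((c - \<omega>) * (c - \<omega> * \<omega>)) = (c - 1) * (c * c - (\<omega> + \<omega> * \<omega>) * c + \<omega> * (\<omega> * \<omega>))"
      by (simp add: algebra_simps)
    also have "\<dots> = (c - 1) * (c * c + c + 1)" by (simp only: 3) (simp add: sum algebra_simps)
    also have "\<dots> = c ^ 3 - 1" by (simp add: power3_eq_cube algebra_simps)
    finally have "c = 1 \<or> c = \<omega> \<or> c = \<omega> * \<omega>" using that by simp
    then show ?thesis using w w2 mat_1_closed by auto
  qed
  \<comment> \<open>For the unitary group nothing yet relates \<open>M\<close> to the Hermitian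
    form, so it has to be checked that the image stays in \<open>K\<close>. The elements for which
    it does form a subgroup, so generators suffice.\<close>
  define H where "H = {A \<in> carrier K. ?\<Psi> A \<in> carrier K}"
  note \<Psi>_mult = contragredient_mult[OF M'(2)]
  have H_sub: "subgroup H K"
  proof (rule subgroupI)
    show "H \<subseteq> carrier K" by (auto simp: H_def)
    have \<Psi>1: "?\<Psi> (mat 1) = mat 1"
      using inv_one by (simp add: contragredient_def transpose_mat M' one_K)
    then have "mat 1 \<in> H" using mat_1_closed by (simp only: H_def mem_Collect_eq)
    then show "H \<noteq> {}" by blast
    fix A assume "A \<in> H"
    then have A: "A \<in> carrier K" "?\<Psi> A \<in> carrier K" by (auto simp: H_def)
    have "?\<Psi> (inv A) ** ?\<Psi> A = ?\<Psi> (inv A ** A)"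
      by (rule \<Psi>_mult[OF inv_closed[OF A(1)] A(1), symmetric])
    also have "\<dots> = mat 1" by (simp only: inv_left[OF A(1)] \<Psi>1)
    finally have "inv (?\<Psi> A) ** ?\<Psi> A = ?\<Psi> (inv A) ** ?\<Psi> A" by (simp only: inv_left[OF A(2)])
    then have "inv (?\<Psi> A) = ?\<Psi> (inv A)" by (rule right_cancel[OF A(2)])
    then show "inv A \<in> H" using A inv_closed[OF A(2)] by (simp add: H_def)
    fix B assume "B \<in> H"
    then show "A \<otimes> B \<in> H" using A by (simp add: H_def mult_K mult_closed \<Psi>_mult)
  qed
  have H_mult: "inv A ** B \<in> H" if "A \<in> H" "B \<in> H" for A B
    using subgroup.m_closed[OF H_sub subgroup.m_inv_closed[OF H_sub that(1)] that(2)] by (simp add: mult_K)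
  have in_H: "X \<in> H" if X: "X \<in> {s 1, t 1 2, t 4 5, t 1 5}" for X
  proof -
    have XK: "X \<in> carrier K" using X sK tK by blast
    obtain c where c: "c ^ 3 = 1" "?\<Psi> X = mat c ** X" using pres[OF X] by blast
    have "?\<Psi> X \<in> carrier K" unfolding c(2) by (rule mult_closed[OF root_in[OF c(1)] XK])
    then show ?thesis using XK unfolding H_def by blast
  qed
  have \<Psi>5: "?\<Psi> (s 5) = inv (s 5)" by (rule contragredient_inverted[OF M'(1) sK(3) M(3)])
  then have s5H: "s 5 \<in> H" using sK(3) inv_closed[OF sK(3)] by (simp add: H_def)
  \<comment> \<open>These two are not among the matrices controlled by the form, but they are
    obtained from \<open>s 1\<close>, \<open>t 1 2\<close> and \<open>t 1 5\<close> by cancelling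
    factors on the left.\<close>
  have tH: "t 2 5 \<in> H" "t 3 5 \<in> H"
  proof -
    have cancel: "X = inv (s i) ** Y" if "Y = s i ** X" "s i \<in> carrier K" for i X Y
      unfolding that(1) by (simp add: matrix_mul_assoc inv_left[OF that(2)])
    have "t 1 5 = s 1 ** t 2 5" using t_Cons[of 1 5] by (simp add: numeral_2_eq_2)
    then have "t 2 5 = inv (s 1) ** t 1 5" using sK(1) by (rule cancel)
    then show 2: "t 2 5 \<in> H" using in_H H_mult by simp
    have "t 1 2 = s 1 ** s 2" using t_Suc[of 1] by (simp add: numeral_2_eq_2)
    then have "s 2 = inv (s 1) ** t 1 2" using sK(1) by (rule cancel)
    then have "s 2 \<in> H" using in_H H_mult by simp
    moreover have "t 2 5 = s 2 ** t 3 5" using t_Cons[of 2 5] by (simp add: numeral_3_eq_3 numeral_2_eq_2)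
    then have "t 3 5 = inv (s 2) ** t 2 5" using sK(2) by (rule cancel)
    ultimately show "t 3 5 \<in> H" using 2 H_mult by simp
  qed
  have "H = carrier K"
  proof (rule generated_by_t[OF H_sub])
    show "scalars K \<subseteq> H"
    proof
      fix z assume "z \<in> scalars K"
      then obtain c where c: "z = mat c" "mat c \<in> carrier K" unfolding scalars_def by blast
      then show "z \<in> H" using contragredient_scalar[OF M'(1) c(2)] unfolding H_def by force
    qed
    fix i assume "1 \<le> i" "i \<le> n"
    then have "i = 1 \<or> i = 2 \<or> i = 3 \<or> i = 4 \<or> i = 5" using n5 by auto
    moreover have "t 1 5 \<in> H" "t 4 5 \<in> H" "t 5 5 \<in> H" using in_H s5H t_same[of 5] by simp_all
    ultimately show "t i n \<in> H" unfolding n5 using tH by blast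
  qed
  then have closed: "?\<Psi> A \<in> carrier K" if "A \<in> carrier K" for A using that unfolding H_def by blast
  have "\<exists>\<phi> \<in> iso Q Q. \<forall>A \<in> carrier K. \<phi> (proj A) = proj (?\<Psi> A)"
    by (rule induced_iso[OF \<Psi>_mult closed contragredient_inj[OF M']])
      (use contragredient_scalar[OF M'(1)] in blast)+
  then obtain \<phi> where \<phi>: "\<phi> \<in> iso Q Q" "\<And>A. A \<in> carrier K \<Longrightarrow> \<phi> (proj A) = proj (?\<Psi> A)" by blast
  have \<phi>_mult: "\<phi> (x \<otimes>\<^bsub>Q\<^esub> y) = \<phi> x \<otimes>\<^bsub>Q\<^esub> \<phi> y" if "x \<in> carrier Q" "y \<in> carrier Q" for x y
    using \<phi>(1) that by (simp add: iso_def hom_def)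
  have \<phi>_fixes: "\<phi> (proj X) = proj X" if X: "X \<in> {s 1, t 1 2, t 4 5, t 1 5}" for X
  proof -
    have XK: "X \<in> carrier K" using X sK tK by blast
    moreover obtain c where "?\<Psi> X = mat c ** X" using pres[OF X] by blast
    ultimately show ?thesis using proj_eq_iff[OF closed[OF XK] XK] \<phi>(2) by auto
  qed
  have \<phi>g: "\<phi> g = g" using \<phi>_fixes[of "t 1 5"] n5 by (simp add: proj_t g_def)
  have \<phi>45: "\<phi> (P.\<tau> 4 5) = P.\<tau> 4 5" using \<phi>_fixes[of "t 4 5"] n5 by (simp add: proj_t)
  have \<phi>12: "\<phi> (P.\<tau> 1 2) = P.\<tau> 1 2" using \<phi>_fixes[of "t 1 2"] n5 by (simp add: proj_t)
  have \<phi>1: "\<phi> (\<sigma> 1) = \<sigma> 1" using \<phi>_fixes[of "s 1"] by simp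
  have \<phi>5: "\<phi> (\<sigma> 5) = inv\<^bsub>Q\<^esub> (\<sigma> 5)" using \<phi>(2)[OF sK(3)] \<Psi>5 proj_inv[OF sK(3)] by simp
  have \<phi>13: "\<phi> (P.\<tau> 1 3) = P.\<tau> 1 3" by (simp only: t45_13 \<phi>_mult[OF g(1) c3(2)] \<phi>g \<phi>45)
  have g14: "g = P.\<tau> 1 4 \<otimes>\<^bsub>Q\<^esub> \<sigma> 5"
    unfolding g_def using P.\<tau>_snoc[of 1 5] n5 n_le by simp
  then have \<sigma>5: "\<sigma> 5 = P.\<tau> 1 4 \<otimes>\<^bsub>Q\<^esub> g" using c3 sq3 by (simp add: Q.m_assoc[symmetric])
  then have t14: "P.\<tau> 1 4 = \<sigma> 5 \<otimes>\<^bsub>Q\<^esub> g" using c3 g by (simp add: Q.m_assoc)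
  have i5: "inv\<^bsub>Q\<^esub> (\<sigma> 5) = g \<otimes>\<^bsub>Q\<^esub> P.\<tau> 1 4"
  proof (rule Q.inv_equality)
    have "(g \<otimes>\<^bsub>Q\<^esub> P.\<tau> 1 4) \<otimes>\<^bsub>Q\<^esub> (P.\<tau> 1 4 \<otimes>\<^bsub>Q\<^esub> g) = g \<otimes>\<^bsub>Q\<^esub> (P.\<tau> 1 4 \<otimes>\<^bsub>Q\<^esub> P.\<tau> 1 4) \<otimes>\<^bsub>Q\<^esub> g"
      using c3 g by (simp only: Q.m_assoc Q.m_closed)
    then show "g \<otimes>\<^bsub>Q\<^esub> P.\<tau> 1 4 \<otimes>\<^bsub>Q\<^esub> \<sigma> 5 = \<one>\<^bsub>Q\<^esub>" using c3 g sq3 by (simp add: \<sigma>5)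
  qed (use c3 g in auto)
  \<comment> \<open>As \<open>\<tau> 1 4 = \<sigma> 5 g\<close> and \<phi> inverts
    \<open>\<sigma> 5\<close> and fixes \<open>g\<close>, \<phi> acts on \<open>\<tau> 1 4\<close>
    as conjugation by \<open>g\<close>; a second conjugation undoes it.\<close>
  have \<phi>14: "g \<otimes>\<^bsub>Q\<^esub> \<phi> (P.\<tau> 1 4) \<otimes>\<^bsub>Q\<^esub> g = P.\<tau> 1 4"
  proof -
    have "\<phi> (P.\<tau> 1 4) = \<phi> (\<sigma> 5) \<otimes>\<^bsub>Q\<^esub> \<phi> g"
      by (simp only: \<phi>_mult[OF c3(4) g(1), symmetric] t14[symmetric])
    then have "\<phi> (P.\<tau> 1 4) = (g \<otimes>\<^bsub>Q\<^esub> P.\<tau> 1 4) \<otimes>\<^bsub>Q\<^esub> g" by (simp only: \<phi>5 \<phi>g i5)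
    then have "g \<otimes>\<^bsub>Q\<^esub> \<phi> (P.\<tau> 1 4) \<otimes>\<^bsub>Q\<^esub> g = (g \<otimes>\<^bsub>Q\<^esub> g) \<otimes>\<^bsub>Q\<^esub> P.\<tau> 1 4 \<otimes>\<^bsub>Q\<^esub> (g \<otimes>\<^bsub>Q\<^esub> g)"
      using c3 g(1) by (simp only: Q.m_assoc Q.m_closed)
    then show ?thesis using c3 g by simp
  qed
  \<comment> \<open>\<open>\<phi>\<close> acts like conjugation by \<open>\<rho>\<^sub>5\<close> and \<open>g\<close> is \<open>\<rho>\<^sub>0\<rho>\<^sub>5\<close>, so \<open>\<theta>\<close> acts like conjugation by \<open>\<rho>\<^sub>0\<close>.\<close>
  define \<theta> where "\<theta> = (\<lambda>x. g \<otimes>\<^bsub>Q\<^esub> x \<otimes>\<^bsub>Q\<^esub> g) \<circ> \<phi>"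
  have "\<theta> \<in> iso Q Q" unfolding \<theta>_def using \<phi>(1) P.conj_iso[OF g] by (rule iso_set_trans)
  moreover have "\<theta> (\<sigma> 1) = inv\<^bsub>Q\<^esub> (\<sigma> 1)"
    using P.\<tau>_inverts_first[of 1 5] n5 n_le by (simp only: \<theta>_def o_def \<phi>1 g_def)
  moreover have "\<theta> (P.\<tau> 1 i) = P.\<tau> 1 i" if "i \<in> {2..r - 1}" for i
  proof -
    have "i = 2 \<or> i = 3 \<or> i = 4 \<or> i = 5" using that r6 by auto
    then show ?thesis
    proof (elim disjE)
      assume i: "i = 2"
      have "g \<otimes>\<^bsub>Q\<^esub> P.\<tau> 1 2 \<otimes>\<^bsub>Q\<^esub> g = P.\<tau> 1 2" by (rule conj_prefix) simp
      then show ?thesis by (simp only: i \<theta>_def o_def \<phi>12)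
    next
      assume i: "i = 3"
      have "g \<otimes>\<^bsub>Q\<^esub> P.\<tau> 1 3 \<otimes>\<^bsub>Q\<^esub> g = P.\<tau> 1 3" by (rule conj_prefix) simp
      then show ?thesis by (simp only: i \<theta>_def o_def \<phi>13)
    next
      assume "i = 4" then show ?thesis by (simp only: \<theta>_def o_def \<phi>14)
    next
      assume "i = 5"
      then have "P.\<tau> 1 i = g" by (simp add: g_def)
      then show ?thesis using g by (simp add: \<theta>_def \<phi>g)
    qed
  qed
  ultimately have "\<not> chirality Q r \<sigma>" unfolding chirality_def by blast
  then show False using chiral by (simp add: gives_chiral_polytope_def)
qed

end

section \<open>Irreducibility of the special linear and special unitary groups\<close>

lemma tau_cong:
  assumes "\<And>i. 1 \<le> i \<Longrightarrow> i \<le> r - 1 \<Longrightarrow> \<sigma> i = \<sigma>' i" and "1 \<le> i" "j \<le> r - 1"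
  shows "tau G \<sigma> i j = tau G \<sigma>' i j"
proof -
  have "map \<sigma> [i..<Suc j] = map \<sigma>' [i..<Suc j]"
    using assms(2,3) by (intro map_cong refl assms(1)) auto
  then show ?thesis by (simp only: tau_def)
qed

text \<open>Only the values at \<open>1\<close> to \<open>r - 1\<close> enter, so lifts need to be
  chosen on this range alone.\<close>

lemma gives_chiral_polytope_cong:
  assumes eq: "\<And>i. 1 \<le> i \<Longrightarrow> i \<le> r - 1 \<Longrightarrow> \<sigma> i = \<sigma>' i"
    and gives: "gives_chiral_polytope G r \<sigma>"
  shows "gives_chiral_polytope G r \<sigma>'"
proof -
  have r: "3 \<le> r" using gives by (simp add: gives_chiral_polytope_def)
  have tau: "tau G \<sigma>' i j = tau G \<sigma> i j" if "1 \<le> i" "j \<le> r - 1" for i j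
    by (rule tau_cong[OF eq that, symmetric])
  have img: "\<sigma>' ` {1..r - 1} = \<sigma> ` {1..r - 1}" using eq by (intro image_cong refl) auto
  have "string_property G r \<sigma>'" using gives
    by (simp add: gives_chiral_polytope_def string_property_def tau)
  moreover have "tau_subgroup G r \<sigma>' I = tau_subgroup G r \<sigma> I" for I
  proof -
    have "{tau G \<sigma>' i j | i j. 1 \<le> i \<and> i \<le> j \<and> j \<le> r - 1 \<and> i - 1 \<notin> I \<and> j \<notin> I} =
        {tau G \<sigma> i j | i j. 1 \<le> i \<and> i \<le> j \<and> j \<le> r - 1 \<and> i - 1 \<notin> I \<and> j \<notin> I}"
      using tau by (intro Collect_cong ex_cong1) auto
    then show ?thesis by (simp only: tau_subgroup_def)
  qed
  then have "intersection_property G r \<sigma>'" using gives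
    by (simp add: gives_chiral_polytope_def intersection_property_def)
  moreover have "\<sigma>' 1 = \<sigma> 1" using eq[of 1] r by simp
  then have "chirality G r \<sigma>'" using gives
    by (simp add: gives_chiral_polytope_def chirality_def tau)
  ultimately show ?thesis using gives unfolding gives_chiral_polytope_def img by blast
qed

lemma (in special_linear_group) not_chiral_polytope:
  assumes "r > 5"
    and "\<And>v. v \<noteq> 0 \<Longrightarrow> \<exists>A \<in> carrier K. \<forall>c. A *v v \<noteq> c *s v"
    and "\<And>f. f \<noteq> 0 \<Longrightarrow> \<exists>A \<in> carrier K. \<forall>c. f v* A \<noteq> c *s f"
  shows "\<not> is_aut_group_of_chiral_polytope Q r"
proof
  assume "is_aut_group_of_chiral_polytope Q r"
  then obtain \<sigma> where \<sigma>: "gives_chiral_polytope Q r \<sigma>" unfolding is_aut_group_of_chiral_polytope_def ..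
  then have "\<sigma> ` {1..r - 1} \<subseteq> proj ` carrier K" by (simp add: gives_chiral_polytope_def carrier_Q)
  then have "\<sigma> i \<in> proj ` carrier K" if "1 \<le> i" "i \<le> r - 1" for i
    using that by (simp add: image_subset_iff)
  then have "\<exists>A. A \<in> carrier K \<and> \<sigma> i = proj A" if "1 \<le> i" "i \<le> r - 1" for i
    using that by blast
  then obtain s where s: "s i \<in> carrier K" "\<sigma> i = proj (s i)" if "1 \<le> i" "i \<le> r - 1" for i by metis
  have "gives_chiral_polytope Q r (\<lambda>i. proj (s i))"
    by (rule gives_chiral_polytope_cong[OF _ \<sigma>]) (rule s(2))
  then interpret chiral_lift K r s using assms s(1) by unfold_locales auto
  show False by (rule chiral_lift_impossible)
qed

lemma special_linear_group_SL: "special_linear_group (SL :: ('a::{field,finite} ^ 3 ^ 3) monoid)"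
  by (intro special_linear_group.intro group_SL special_linear_group_axioms.intro) (auto simp: SL_def)

text \<open>A transvection adds the nonzero coordinate \<open>v $ i\<close> to another one:
  coordinate \<open>i\<close> forces the eigenvalue 1, while coordinate \<open>j\<close>
  changes.\<close>

lemma SL_no_line:
  fixes v :: "'a::field ^ 3"
  assumes "v \<noteq> 0"
  shows "\<exists>A \<in> carrier SL. \<forall>c. A *v v \<noteq> c *s v"
proof -
  obtain i where i: "v $ i \<noteq> 0" using assms by (auto simp: vec_eq_iff)
  define j :: 3 where "j = (if i = 1 then 2 else 1)"
  have ij: "i \<noteq> j" by (simp add: j_def)
  define A where "A = mat 1 + outer (axis j 1 :: 'a ^ 3) (axis i 1 :: 'a ^ 3)"
  have "det A = 1"
    using exhaust_3[of i] ij by (auto simp: A_def j_def det_3 outer_def mat_def axis_def)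
  moreover have "A *v v \<noteq> c *s v" for c
  proof
    have "dot (axis i 1) v = v $ i"
      by (simp add: dot_def axis_def if_distrib[where f="\<lambda>a. a * _"] cong: if_cong)
    then have Av: "A *v v = v + v $ i *s axis j 1"
      by (simp add: A_def matrix_vector_mult_add_rdistrib outer_mult_vec)
    assume "A *v v = c *s v"
    then have e: "v $ k + v $ i * axis j 1 $ k = c * v $ k" for k
      unfolding Av by (simp add: vec_eq_iff)
    have "c = 1" using e[of i] i ij by (simp add: axis_def)
    then show False using e[of j] i by (simp add: axis_def)
  qed
  ultimately show ?thesis by (intro bexI[of _ A]) (auto simp: SL_def)
qed

lemma SL_no_plane:
  fixes f :: "'a::field ^ 3"
  assumes "f \<noteq> 0"
  shows "\<exists>A \<in> carrier SL. \<forall>c. f v* A \<noteq> c *s f"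
proof -
  obtain A where "A \<in> carrier SL" "\<forall>c. A *v f \<noteq> c *s f" using SL_no_line[OF assms] by blast
  then show ?thesis by (intro bexI[of _ "transpose A"]) (auto simp: SL_def det_transpose)
qed

section \<open>Elements of norm one and irreducibility of the unitary group\<close>

lemma power_card_eq:
  fixes x :: "'a::{field,finite}"
  shows "x ^ CARD('a) = x"
proof (cases "x = 0")
  case False
  let ?U = "UNIV - {0 :: 'a}"
  \<comment> \<open>Multiplication by \<open>x\<close> permutes the units; comparing their product
    before and after gives \<open>x ^ card ?U = 1\<close>.\<close>
  have "bij_betw (\<lambda>y. x * y) ?U ?U"
    by (rule bij_betw_byWitness[where f'="\<lambda>y. y / x"]) (use False in auto)
  then have "(\<Prod>y\<in>?U. x * y) = \<Prod>?U" by (rule prod.reindex_bij_betw)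
  then have "x ^ card ?U * \<Prod>?U = 1 * \<Prod>?U" by (simp add: prod.distrib)
  moreover have "\<Prod>?U \<noteq> 0" by simp
  ultimately have "x ^ card ?U = 1" by (metis mult_right_cancel)
  moreover have "CARD('a) = Suc (card ?U)" by (simp add: card_Suc_Diff1)
  ultimately show ?thesis by (simp only: power_Suc mult_1_right)
qed (simp add: card_gt_0_iff)

text \<open>At most \<open>q\<close> elements satisfy \<open>x ^ q = x\<close>, fewer than
  \<open>q\<^sup>2\<close>. For any other \<open>y\<close> the quotient \<open>y ^ q / y\<close> is
  not 1, and its norm is 1 because taking the \<open>q\<close>-th power twice is the
  identity.\<close>

lemma exists_norm_one:
  assumes q: "q \<ge> 2" and card: "CARD('a::{field,finite}) = q\<^sup>2"
  shows "\<exists>a :: 'a. a * a ^ q = 1 \<and> a \<noteq> 1"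
proof -
  define p :: "'a poly" where "p = monom 1 q - monom 1 1"
  have "poly.coeff p q = 1" using q by (simp add: p_def)
  then have "p \<noteq> 0" by auto
  have "degree p \<le> q" unfolding p_def using q by (intro degree_diff_le) (simp_all add: degree_monom_eq)
  then have "card {x. poly p x = 0} \<le> q" using card_poly_roots_bound[OF \<open>p \<noteq> 0\<close>] by linarith
  moreover have "q < CARD('a)" unfolding card using q by (simp add: power2_eq_square)
  ultimately have "{x. poly p x = 0} \<noteq> UNIV" by auto
  then obtain y where "poly p y \<noteq> 0" by blast
  then have y: "y ^ q \<noteq> y" by (auto simp: p_def poly_monom)
  then have y0: "y \<noteq> 0" using q by (auto simp: zero_power)
  have yq: "(y ^ q) ^ q = y" using power_card_eq[of y] by (simp add: card power_mult power2_eq_square)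
  have "(y ^ q / y) * (y ^ q / y) ^ q = 1" using y0 by (simp add: power_divide yq)
  moreover have "y ^ q / y \<noteq> 1" using y y0 by simp
  ultimately show ?thesis by blast
qed

text \<open>Two unitary matrices suffice: a cyclic permutation \<open>P\<close>, whose eigenvectors
  have no zero coordinate, and the diagonal \<open>D\<close> with entries \<open>a\<close>,
  \<open>1 / a\<close>, \<open>1\<close>, which could have such an eigenvector only for
  \<open>a = 1\<close>. \<open>absurd\<close> leaves the cyclic order open so that it serves columns
  and rows.\<close>

lemma SU_no_line_plane:
  fixes v :: "'a::{field,finite} ^ 3"
  assumes q: "q \<ge> 2" and card: "CARD('a) = q\<^sup>2" and "v \<noteq> 0"
  shows "\<exists>A \<in> carrier (SU q). \<forall>c. A *v v \<noteq> c *s v" "\<exists>A \<in> carrier (SU q). \<forall>c. v v* A \<noteq> c *s v"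
proof -
  obtain a :: 'a where a: "a * a ^ q = 1" "a \<noteq> 1" using exists_norm_one[OF q card] by blast
  then have a0: "a \<noteq> 0" by auto
  have q0: "0 ^ q = (0 :: 'a)" using q by simp
  define P :: "'a ^ 3 ^ 3" where
    "P = (\<chi> i j. if (i = 1 \<and> j = 2) \<or> (i = 2 \<and> j = 3) \<or> (i = 3 \<and> j = 1) then 1 else 0)"
  define D :: "'a ^ 3 ^ 3" where
    "D = (\<chi> i j. if i = j then (if i = 1 then a else if i = 2 then 1 / a else 1) else 0)"
  have P: "P \<in> carrier (SU q)"
    by (simp add: SU_def P_def det_3 conj_transpose_def transpose_def map_matrix_def q0
        matrix_matrix_mult_def vec_eq_iff forall_3 sum_3 mat_def)
  have D: "D \<in> carrier (SU q)"
    using a(1) a0 by (simp add: SU_def D_def det_3 conj_transpose_def transpose_def map_matrix_def q0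
        matrix_matrix_mult_def vec_eq_iff forall_3 sum_3 mat_def power_divide)
  have absurd: False if "c * x = y" "c * y = z" "c * z = x" "d * v $ 1 = a * v $ 1" "d * v $ 3 = v $ 3"
      "{x, y, z} = {v $ 1, v $ 2, v $ 3}" for c d x y z
  proof -
    have "x = 0 \<longleftrightarrow> y = 0" "y = 0 \<longleftrightarrow> z = 0" using that(1-3) by auto
    then have "(\<forall>w \<in> {x, y, z}. w = 0) \<or> (\<forall>w \<in> {x, y, z}. w \<noteq> 0)" by auto
    then have "v $ 1 \<noteq> 0" "v $ 3 \<noteq> 0"
      unfolding that(6) using \<open>v \<noteq> 0\<close> by (auto simp: vec_eq_iff forall_3)
    then show False using that(4,5) a(2) by auto
  qed
  show "\<exists>A \<in> carrier (SU q). \<forall>c. A *v v \<noteq> c *s v"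
  proof (rule ccontr)
    assume "\<not> ?thesis"
    then obtain c d where h: "P *v v = c *s v" "D *v v = d *s v" using P D by blast
    have "(P *v v) $ 1 = v $ 2" "(P *v v) $ 2 = v $ 3" "(P *v v) $ 3 = v $ 1"
      "(D *v v) $ 1 = a * v $ 1" "(D *v v) $ 3 = v $ 3"
      by (simp_all add: P_def D_def matrix_vector_mult_def sum_3)
    note e = this[unfolded h vector_smult_component]
    show False by (rule absurd[OF e]) simp
  qed
  show "\<exists>A \<in> carrier (SU q). \<forall>c. v v* A \<noteq> c *s v"
  proof (rule ccontr)
    assume "\<not> ?thesis"
    then obtain c d where h: "v v* P = c *s v" "v v* D = d *s v" using P D by blast
    have "(v v* P) $ 1 = v $ 3" "(v v* P) $ 3 = v $ 2" "(v v* P) $ 2 = v $ 1"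
      "(v v* D) $ 1 = a * v $ 1" "(v v* D) $ 3 = v $ 3"
      by (simp_all add: P_def D_def vector_matrix_mult_def sum_3)
    note e = this[unfolded h vector_smult_component]
    show False by (rule absurd[OF e]) auto
  qed
qed

lemma special_linear_group_SU:
  assumes "primepow q" and "CARD('a::{field,finite}) = q\<^sup>2"
  shows "special_linear_group (SU q :: ('a ^ 3 ^ 3) monoid)"
  by (intro special_linear_group.intro group_SU[OF assms] special_linear_group_axioms.intro)
    (auto simp: SU_def)

theorem theorem1p3:
  fixes q r :: nat
  assumes "q \<ge> 2" and "primepow q" and "r > 5"
  shows "(CARD('a::{field,finite}) = q \<longrightarrow>
            \<not> is_aut_group_of_chiral_polytope (PSL :: ('a ^ 3 ^ 3) set monoid) r) \<and>
         (CARD('b::{field,finite}) = q\<^sup>2 \<longrightarrow>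
            \<not> is_aut_group_of_chiral_polytope (PSU q :: ('b ^ 3 ^ 3) set monoid) r)"
proof (intro conjI impI)
  interpret L: special_linear_group "SL :: ('a ^ 3 ^ 3) monoid" by (rule special_linear_group_SL)
  show "\<not> is_aut_group_of_chiral_polytope (PSL :: ('a ^ 3 ^ 3) set monoid) r"
    using L.not_chiral_polytope[OF assms(3) SL_no_line SL_no_plane] by (simp add: L.Q_def PSL_def)
next
  assume card: "CARD('b) = q\<^sup>2"
  interpret U: special_linear_group "SU q :: ('b ^ 3 ^ 3) monoid"
    by (rule special_linear_group_SU[OF assms(2) card])
  show "\<not> is_aut_group_of_chiral_polytope (PSU q :: ('b ^ 3 ^ 3) set monoid) r"
    using U.not_chiral_polytope[OF assms(3) SU_no_line_plane[OF assms(1) card]]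
    by (simp add: U.Q_def PSU_def)
qed

end
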